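(* Let $d\ge 2$ and $p\in(0,1)$. The sequence of random measures $\mu_L$ (as $L\to\infty$ through the positive integers) converges in probability, with respect to total variation distance, to a deterministic probability measure $\mu$ on $\mathcal{G}$ whose support is all of $\mathcal{G}$ (i.e. $\mu(\{\gamma\})>0$ for every $\gamma\in\mathcal{G}$).
   Context: Fix $d\ge2$ and $p\in(0,1)$. For $x\in\mathbb{Z}^d$ and a positive integer $\ell$ let $B_\ell(x)=\prod_{i=1}^d[x_i,x_i+\ell]$. Each point of $\mathbb{Z}^d$ is independently colored black with probability $p$ and white with probability $1-p$; $Z$ is the random set of black points, and $\Phi=\big(\bigcup_{z\in Z}B_1(z)\big)^{\circ}$ is the interior (in $\mathbb{R}^d$) of the union of the black unit cubes. $\mathcal{G}$ denotes the (countable) set of equivalence classes, up to homotopy equivalence, of finite connected $d$-dimensional cubical complexes, i.e. of nonempty connected sets of the form $\big(\bigcup_{z\in F}B_1(z)\big)^{\circ}$ with $F\subset\mathbb{Z}^d$ finite. For a positive integer $L$, let $W_L(0)=\prod_{i=1}^d[-\lfloor L/2\rfloor,\lceil L/2\rceil]$ and let $\Phi_L$ be the union of the connected components of $\Phi$ that are completely contained in $W_L(0)$. Let $b_0(\Phi_L)$ be the number of connected components of $\Phi_L$. The random probability measure $\mu_L$ on $\mathcal{G}$ is $$\mu_L=\frac{1}{b_0(\Phi_L)}\sum_{s}\delta_{[s]},$$ where the sum is over the connected components $s$ of $\Phi_L$ and $[s]\in\mathcal{G}$ is the homotopy type of $s$. On the event $b_0(\Phi_L)=0$, $\mu_L$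 is set to be an arbitrary fixed probability measure on $\mathcal{G}$. A sequence of random measures $\mu_n$ converges in probability to $\mu$ if for every $\varepsilon>0$, $\lim_{n\to\infty}\mathbb{P}\{d(\mu_n,\mu)>\varepsilon\}=0$, where $d(\mu_1,\mu_2)=\sup_{A}|\mu_1(A)-\mu_2(A)|$ is the total variation distance. *)

theory Defs
  imports "HOL-Probability.Probability"
begin

definition lattice_cube :: "nat \<Rightarrow> int ^ 'd \<Rightarrow> (real ^ 'd) set" where
  "lattice_cube l x =
     cbox (\<chi> i. real_of_int (x $ i)) (\<chi> i. real_of_int (x $ i) + real l)"

definition cube_interior :: "(int ^ 'd) set \<Rightarrow> (real ^ 'd) set" where
  "cube_interior Z = interior (\<Union>z\<in>Z. lattice_cube 1 z)"

definition cubical_complexes :: "(real ^ 'd) set set" where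
  "cubical_complexes =
     {S. S \<noteq> {} \<and> connected S \<and> (\<exists>F. finite F \<and> S = cube_interior F)}"

definition homotopy_rel :: "((real ^ 'd) set \<times> (real ^ 'd) set) set" where
  "homotopy_rel =
     {(S, T). S \<in> cubical_complexes \<and> T \<in> cubical_complexes \<and> S homotopy_eqv T}"

definition homotopy_type :: "(real ^ 'd) set \<Rightarrow> (real ^ 'd) set set" where
  "homotopy_type S = homotopy_rel `` {S}"

definition homotopy_types :: "(real ^ 'd) set set set" where
  "homotopy_types = cubical_complexes // homotopy_rel"

definition window :: "nat \<Rightarrow> (real ^ 'd) set" where
  "window L =
     cbox (\<chi> i. - real_of_int \<lfloor>real L / 2\<rfloor>) (\<chi> i. real_of_int \<lceil>real L / 2\<rceil>)"

definition Phi_window :: "(int ^ 'd) set \<Rightarrow> nat \<Rightarrow> (real ^ 'd) set" where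
  "Phi_window Z L = \<Union> {S \<in> components (cube_interior Z). S \<subseteq> window L}"

definition b0 :: "(real ^ 'd) set \<Rightarrow> nat" where
  "b0 S = card (components S)"

text \<open>The summand \<open>indicator A (homotopy_type s)\<close> is the Dirac mass at the type of
  \<open>s\<close>, evaluated at \<open>A\<close>; the measure \<open>\<nu>\<close> is the value used when no component of
  \<open>Phi\<close> lies in the window. There are only finitely many components in a window, so
  the cardinality and the sum are genuine.\<close>

definition empirical_measure ::
    "(real ^ 'd) set set measure \<Rightarrow> (int ^ 'd) set \<Rightarrow> nat \<Rightarrow> (real ^ 'd) set set measure" where
  "empirical_measure \<nu> Z L =
     (if b0 (Phi_window Z L) = 0 then \<nu>
      else measure_of homotopy_types (Pow homotopy_types)
             (\<lambda>A. (\<Sum>s\<in>components (Phi_window Z L). indicator A (homotopy_type s))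
                   / ennreal (real (b0 (Phi_window Z L)))))"

definition tv_dist :: "'b measure \<Rightarrow> 'b measure \<Rightarrow> real" where
  "tv_dist \<mu>1 \<mu>2 = (SUP A\<in>sets \<mu>1. \<bar>measure \<mu>1 A - measure \<mu>2 A\<bar>)"

text \<open>Since \<open>measure\<close> is 0 on non-measurable sets, the measurability of the deviation
  events is demanded explicitly; otherwise the limit could hold vacuously.\<close>

definition tendsto_in_prob :: "'w measure \<Rightarrow> (nat \<Rightarrow> 'w \<Rightarrow> 'b measure) \<Rightarrow> 'b measure \<Rightarrow> bool" where
  "tendsto_in_prob M X \<mu> \<longleftrightarrow>
     (\<forall>\<epsilon>>0. (\<forall>n. {\<omega> \<in> space M. tv_dist (X n \<omega>) \<mu> > \<epsilon>} \<in> sets M) \<and>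
            (\<lambda>n. measure M {\<omega> \<in> space M. tv_dist (X n \<omega>) \<mu> > \<epsilon>}) \<longlonglongrightarrow> 0)"

definition random_coloring :: "'w measure \<Rightarrow> ('w \<Rightarrow> (int ^ 'd) set) \<Rightarrow> real \<Rightarrow> bool" where
  "random_coloring M Z p \<longleftrightarrow>
     prob_space.indep_vars M (\<lambda>_. count_space UNIV) (\<lambda>x \<omega>. x \<in> Z \<omega>) UNIV \<and>
     (\<forall>x. measure M {\<omega> \<in> space M. x \<in> Z \<omega>} = p)"

end

theory Submission
  imports Defs
begin

text \<open>
  A cluster, that is, a component of \<open>\<Phi>\<close> inside the window, is determined by the finite set of lattice cells that it
  contains. Whether a given finite set \<open>F\<close> of cells forms a cluster depends only on the colours of
  \<open>F\<close> and of the cells touching it (lemma \<open>component_local\<close>). Up to translation there are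
  countably many possible sets \<open>F\<close>, the shapes, and the homotopy type of a cluster is a function of its shape.

  For a shape \<open>F\<close>, let \<open>N\<^sub>F\<close> be the number of clusters in the window that are translates of \<open>F\<close>. It
  is a sum of about \<open>L\<^sup>d\<close> indicators, all with the same probability \<open>q\<^sub>F\<close> and with finite range of
  dependence, so a second moment estimate gives \<open>N\<^sub>F / L\<^sup>d \<longlonglongrightarrow> q\<^sub>F\<close> in mean (lemma
  \<open>deviation_tendsto_0\<close>). If every shape is normalised to contain the origin, the events that \<open>F\<close> is a cluster
  exclude one another for different shapes. Hence the \<open>q\<^sub>F\<close> have sum at most 1, and since
  the expectation of \<open>\<bar>N\<^sub>F / L\<^sup>d - q\<^sub>F\<bar>\<close> is at most \<open>2 * q\<^sub>F\<close>, dominated convergence shows that the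
  expectation of \<open>D = (\<Sum>F. \<bar>N\<^sub>F / L\<^sup>d - q\<^sub>F\<bar>)\<close> tends to 0.

  Let \<open>Q\<close> be the sum of the \<open>q\<^sub>F\<close> and let \<open>\<mu>\<close> be the image of the distribution \<open>q\<^sub>F / Q\<close> on
  shapes under the map to homotopy types. An elementary estimate for quotients gives total variation distance at most
  \<open>2 * D / Q\<close> between \<open>\<mu>\<close> and the empirical measure (lemma \<open>tv_dist_empirical_le\<close>), and Markov's
  inequality yields convergence in probability. The support is full because every type is the type
  of a shape, and \<open>q\<^sub>F > 0\<close>: with positive probability the cells of \<open>F\<close> are black and
  those around it white.
\<close>

(* Keeps the numeral in lattice_cube 1 from being rewritten to Suc 0. *)
declare One_nat_def [simp del]

section \<open>Unit cubes and the components of their unions\<close>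

definition real_point :: "int ^ 'd \<Rightarrow> real ^ 'd" where
  "real_point x = (\<chi> i. real_of_int (x $ i))"

definition cube_center :: "int ^ 'd \<Rightarrow> real ^ 'd" where
  "cube_center x = (\<chi> i. real_of_int (x $ i) + 1/2)"

text \<open>
  For a component of a union of black cubes this recovers the black cells that make it up. Testing
  a single interior point works because a component contains either all of the interior of a
  unit cube or none of it.
\<close>

definition cells :: "(real ^ 'd) set \<Rightarrow> (int ^ 'd) set" where
  "cells S = {z. cube_center z \<in> S}"

definition neighbourhood :: "(int ^ 'd) set \<Rightarrow> (int ^ 'd) set" where
  "neighbourhood F = {z. \<exists>w\<in>F. \<forall>i. \<bar>z $ i - w $ i\<bar> \<le> 1}"

lemma mem_lattice_cube:
  "x \<in> lattice_cube 1 z \<longleftrightarrow> (\<forall>i. real_of_int (z $ i) \<le> x $ i \<and> x $ i \<le> real_of_int (z $ i) + 1)"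
  by (simp add: lattice_cube_def mem_box_cart)

lemma mem_interior_lattice_cube:
  "x \<in> interior (lattice_cube 1 z) \<longleftrightarrow>
     (\<forall>i. real_of_int (z $ i) < x $ i \<and> x $ i < real_of_int (z $ i) + 1)"
  by (simp add: lattice_cube_def mem_box_cart interior_cbox)

lemma center_mem_interior: "cube_center z \<in> interior (lattice_cube 1 z)"
  by (simp add: mem_interior_lattice_cube cube_center_def)

lemma center_mem_cube_iff: "cube_center z \<in> lattice_cube 1 w \<longleftrightarrow> z = w"
proof
  assume *: "cube_center z \<in> lattice_cube 1 w"
  have "z $ i = w $ i" for i
  proof -
    have "real_of_int (w $ i) \<le> real_of_int (z $ i) + 1/2"
      "real_of_int (z $ i) + 1/2 \<le> real_of_int (w $ i) + 1"
      using * by (auto simp: mem_lattice_cube cube_center_def)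
    then show ?thesis by linarith
  qed
  then show "z = w" by (simp add: vec_eq_iff)
next
  assume "z = w" then show "cube_center z \<in> lattice_cube 1 w"
    using center_mem_interior interior_subset by blast
qed

lemma interior_cube_subset: "z \<in> Z \<Longrightarrow> interior (lattice_cube 1 z) \<subseteq> cube_interior Z"
  unfolding cube_interior_def by (intro interior_mono) auto

lemma cube_interior_subset: "cube_interior Z \<subseteq> (\<Union>z\<in>Z. lattice_cube 1 z)"
  unfolding cube_interior_def by (rule interior_subset)

lemma open_cube_interior: "open (cube_interior Z)"
  by (simp add: cube_interior_def)

lemma cube_center_mem_iff: "cube_center z \<in> cube_interior Z \<longleftrightarrow> z \<in> Z"
  using cube_interior_subset[of Z] interior_cube_subset[of z Z] center_mem_interior[of z]
  by (auto simp: center_mem_cube_iff)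

lemma cells_cube_interior [simp]: "cells (cube_interior Z) = Z"
  by (simp add: cells_def cube_center_mem_iff)

lemma connected_interior_cube: "connected (interior (lattice_cube 1 z))"
  by (simp add: lattice_cube_def convex_connected convex_interior)

lemma open_meets_interior_cube:
  assumes "open U" "U \<inter> lattice_cube 1 z \<noteq> {}"
  shows "U \<inter> interior (lattice_cube 1 z) \<noteq> {}"
proof -
  have ne: "box (\<chi> i. real_of_int (z $ i)) (\<chi> i. real_of_int (z $ i) + 1) \<noteq> {}"
    using center_mem_interior[of z] by (auto simp: lattice_cube_def interior_cbox)
  have "closure (interior (lattice_cube 1 z)) = lattice_cube 1 z"
    using closure_box[OF ne] by (simp add: lattice_cube_def interior_cbox)
  then show ?thesis
    using open_Int_closure_eq_empty[OF assms(1)] assms(2) by metis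
qed

text \<open>
  A point of the union lies in the closure of the interior of some cube, so every neighbourhood of
  it meets such an interior. A connected neighbourhood together with this cube interior is
  connected, and hence belongs to a single component. Both inclusions rest on this remark.
\<close>

lemma component_eq_cube_interior:
  assumes S: "S \<in> components (cube_interior Z)"
  shows "S = cube_interior (cells S)"
proof
  have oS: "open S" using S open_cube_interior open_components by blast
  have sub: "S \<subseteq> cube_interior Z" using S in_components_subset by blast
  have "S \<subseteq> (\<Union>z\<in>cells S. lattice_cube 1 z)"
  proof
    fix x assume x: "x \<in> S"
    then obtain z where z: "z \<in> Z" "x \<in> lattice_cube 1 z"
      using sub cube_interior_subset by blast
    then have "S \<inter> interior (lattice_cube 1 z) \<noteq> {}"
      using open_meets_interior_cube[OF oS] x by blast
    then have "interior (lattice_cube 1 z) \<subseteq> S"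
      using components_maximal[OF S connected_interior_cube interior_cube_subset[OF z(1)]] by blast
    then have "z \<in> cells S"
      using center_mem_interior by (auto simp: cells_def)
    then show "x \<in> (\<Union>z\<in>cells S. lattice_cube 1 z)" using z by blast
  qed
  then show "S \<subseteq> cube_interior (cells S)"
    unfolding cube_interior_def by (rule interior_maximal[OF _ oS])
  show "cube_interior (cells S) \<subseteq> S"
  proof
    fix x assume "x \<in> cube_interior (cells S)"
    then obtain e where e: "e > 0" "ball x e \<subseteq> (\<Union>z\<in>cells S. lattice_cube 1 z)"
      unfolding cube_interior_def by (meson mem_interior)
    have cZ: "cells S \<subseteq> Z"
      using sub by (auto simp: cells_def cube_center_mem_iff subset_iff)
    obtain z where z: "z \<in> cells S" "x \<in> lattice_cube 1 z"
      using e centre_in_ball by blast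
    have "ball x e \<inter> interior (lattice_cube 1 z) \<noteq> {}"
      using open_meets_interior_cube[of "ball x e" z] z e by (metis IntI centre_in_ball empty_iff open_ball)
    then have con: "connected (ball x e \<union> interior (lattice_cube 1 z))"
      by (intro connected_Un connected_interior_cube) auto
    have "ball x e \<subseteq> cube_interior Z"
      unfolding cube_interior_def using e cZ by (intro interior_maximal) auto
    moreover have "cube_center z \<in> S \<inter> (ball x e \<union> interior (lattice_cube 1 z))"
      using z center_mem_interior by (auto simp: cells_def)
    ultimately have "ball x e \<union> interior (lattice_cube 1 z) \<subseteq> S"
      using components_maximal[OF S con] interior_cube_subset[of z Z] z cZ by blast
    then show "x \<in> S" using e by auto
  qed
qed

text \<open>
  The open box with corners \<open>\<lceil>x\<rceil> - 1\<close> and \<open>\<lfloor>x\<rfloor> + 1\<close> is a neighbourhood of \<open>x\<close> that meets only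
  those lattice cubes that contain \<open>x\<close>. So membership of \<open>x\<close> in the interior is
  decided by the cells around \<open>x\<close>, which are neighbours of every cell containing \<open>x\<close>.
\<close>

lemma cube_interior_local:
  assumes "w \<in> F" "x \<in> lattice_cube 1 w" "Z \<inter> neighbourhood F = Z' \<inter> neighbourhood F"
    "x \<in> cube_interior Z"
  shows "x \<in> cube_interior Z'"
proof -
  define U where "U = box (\<chi> i. real_of_int (\<lceil>x $ i\<rceil> - 1)) (\<chi> i. real_of_int (\<lfloor>x $ i\<rfloor> + 1))"
  have xU: "x \<in> U"
    unfolding U_def mem_box_cart by (simp; linarith)
  have near: "x \<in> lattice_cube 1 z" if "y \<in> U" "y \<in> lattice_cube 1 z" for y z
    unfolding mem_lattice_cube
  proof
    fix i
    have "real_of_int (\<lceil>x $ i\<rceil> - 1) < y $ i" "y $ i < real_of_int (\<lfloor>x $ i\<rfloor> + 1)"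
      "real_of_int (z $ i) \<le> y $ i" "y $ i \<le> real_of_int (z $ i) + 1"
      using that by (auto simp: U_def mem_box_cart mem_lattice_cube)
    then have "real_of_int (z $ i) < real_of_int (\<lfloor>x $ i\<rfloor> + 1)"
      "real_of_int (\<lceil>x $ i\<rceil> - 1) < real_of_int (z $ i + 1)" by simp_all
    then have "z $ i \<le> \<lfloor>x $ i\<rfloor>" "\<lceil>x $ i\<rceil> \<le> z $ i + 1"
      by linarith+
    then show "real_of_int (z $ i) \<le> x $ i \<and> x $ i \<le> real_of_int (z $ i) + 1"
      by linarith
  qed
  have nb: "z \<in> neighbourhood F" if "x \<in> lattice_cube 1 z" for z
  proof -
    have "\<bar>z $ i - w $ i\<bar> \<le> 1" for i
    proof -
      have "real_of_int (z $ i) \<le> x $ i" "x $ i \<le> real_of_int (z $ i) + 1"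
        "real_of_int (w $ i) \<le> x $ i" "x $ i \<le> real_of_int (w $ i) + 1"
        using that assms(2) by (auto simp: mem_lattice_cube)
      then show ?thesis by linarith
    qed
    then show ?thesis using assms(1) by (auto simp: neighbourhood_def)
  qed
  have "U \<inter> cube_interior Z \<subseteq> (\<Union>z\<in>Z'. lattice_cube 1 z)"
  proof
    fix y assume y: "y \<in> U \<inter> cube_interior Z"
    then obtain z where "z \<in> Z" "y \<in> lattice_cube 1 z" using cube_interior_subset by blast
    then show "y \<in> (\<Union>z\<in>Z'. lattice_cube 1 z)"
      using near[of y z] nb[of z] y assms(3) by blast
  qed
  moreover have "open (U \<inter> cube_interior Z)" unfolding U_def by (intro open_Int open_box open_cube_interior)
  ultimately show ?thesis
    unfolding cube_interior_def[of Z'] using xU assms(4) by (meson IntI interiorI)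
qed

lemma open_closedin_connected_component:
  assumes "openin (top_of_set T) S" "closedin (top_of_set T) S" "connected S" "S \<noteq> {}"
  shows "S \<in> components T"
  unfolding in_components_maximal
proof (intro conjI allI impI)
  show "S \<subseteq> T" using assms(1) openin_imp_subset by blast
  fix D assume D: "D \<noteq> {} \<and> S \<subseteq> D \<and> D \<subseteq> T \<and> connected D"
  have "openin (top_of_set D) S" "closedin (top_of_set D) S"
    using assms D by (meson openin_subset_trans closedin_subset_trans)+
  then show "D = S" using D assms(4) by (metis connected_clopen)
qed (use assms in auto)

text \<open>
  The key locality statement. A connected open set is a component as soon as it is relatively
  closed. The closure of \<open>cube_interior F\<close> lies in the union \<open>K\<close> of its closed cubes, and on \<open>K\<close> the
  two colourings produce the same open set.
\<close>

lemma component_local: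
  assumes "finite F" "Z \<inter> neighbourhood F = Z' \<inter> neighbourhood F"
    "cube_interior F \<in> components (cube_interior Z)"
  shows "cube_interior F \<in> components (cube_interior Z')"
proof -
  define K where "K = (\<Union>z\<in>F. lattice_cube 1 z)"
  have "closed K" unfolding K_def using assms(1) by (auto simp: lattice_cube_def)
  obtain C where C: "closed C" "cube_interior F = cube_interior Z \<inter> C"
    using closedin_component[OF assms(3)] by (auto simp: closedin_closed)
  have "cube_interior Z \<inter> K = cube_interior Z' \<inter> K"
    unfolding K_def using cube_interior_local assms(2) by blast
  moreover have "cube_interior F \<subseteq> K" unfolding K_def by (rule cube_interior_subset)
  ultimately have eq: "cube_interior F = cube_interior Z' \<inter> (C \<inter> K)" using C by blast
  show ?thesis
  proof (rule open_closedin_connected_component)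
    show "openin (top_of_set (cube_interior Z')) (cube_interior F)"
      using eq open_cube_interior[of F] by (metis Int_lower1 open_subset)
    show "closedin (top_of_set (cube_interior Z')) (cube_interior F)"
      using eq C(1) \<open>closed K\<close> by (metis closed_Int closedin_closed)
    show "connected (cube_interior F)" "cube_interior F \<noteq> {}"
      using assms(3) in_components_connected in_components_nonempty by blast+
  qed
qed

lemma component_local_iff:
  assumes "finite F" "Z \<inter> neighbourhood F = Z' \<inter> neighbourhood F"
  shows "cube_interior F \<in> components (cube_interior Z) \<longleftrightarrow>
         cube_interior F \<in> components (cube_interior Z')"
  using component_local[OF assms] component_local[OF assms(1) assms(2)[symmetric]] by blast

section \<open>Translations\<close>

lemma cube_center_add: "cube_center (x + z) = real_point x + cube_center z"
  by (simp add: real_point_def cube_center_def vec_eq_iff)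

lemma lattice_cube_translation: "lattice_cube 1 (x + z) = (+) (real_point x) ` lattice_cube 1 z"
proof -
  have "(\<chi> i. real_of_int ((x + z) $ i)) = real_point x + (\<chi> i. real_of_int (z $ i))"
    "(\<chi> i. real_of_int ((x + z) $ i) + real 1) = real_point x + (\<chi> i. real_of_int (z $ i) + real 1)"
    by (simp_all add: real_point_def vec_eq_iff)
  then show ?thesis unfolding lattice_cube_def by (simp only: cbox_translation)
qed

lemma cube_interior_translation:
  "cube_interior ((+) x ` F) = (+) (real_point x) ` cube_interior F"
proof -
  have "(\<Union>z\<in>(+) x ` F. lattice_cube 1 z) = (+) (real_point x) ` (\<Union>z\<in>F. lattice_cube 1 z)"
    by (simp add: lattice_cube_translation image_UN)
  then show ?thesis unfolding cube_interior_def by (simp only: interior_translation)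
qed

lemma component_translation:
  fixes T :: "'a::real_normed_vector set"
  assumes "S \<in> components T"
  shows "(+) a ` S \<in> components ((+) a ` T)"
  using assms unfolding in_components_maximal
proof (elim conjE, intro conjI allI impI)
  assume S: "S \<noteq> {}" "S \<subseteq> T" "connected S"
    "\<forall>D. D \<noteq> {} \<and> S \<subseteq> D \<and> D \<subseteq> T \<and> connected D \<longrightarrow> D = S"
  have con: "connected ((+) b ` X)" if "connected X" for b :: 'a and X
    using that by (intro connected_continuous_image continuous_intros)
  show "connected ((+) a ` S)" using S con by blast
  fix D assume D: "D \<noteq> {} \<and> (+) a ` S \<subseteq> D \<and> D \<subseteq> (+) a ` T \<and> connected D"
  have inv: "(+) (-a) ` (+) a ` X = X" for X :: "'a set" by (simp add: image_image)
  have "(+) (-a) ` D \<noteq> {}" using D by blast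
  moreover have "S \<subseteq> (+) (-a) ` D"
    using D image_mono[of "(+) a ` S" D "(+) (-a)"] unfolding inv by blast
  moreover have "(+) (-a) ` D \<subseteq> T"
    using D image_mono[of D "(+) a ` T" "(+) (-a)"] unfolding inv by blast
  moreover have "connected ((+) (-a) ` D)" using D con by blast
  ultimately have "(+) (-a) ` D = S" using S(4)[rule_format, of "(+) (-a) ` D"] by simp
  then have "(+) a ` (+) (-a) ` D = (+) a ` S" by simp
  then show "D = (+) a ` S" by (simp add: image_image)
qed auto

lemma component_translation_iff:
  "cube_interior ((+) x ` F) \<in> components (cube_interior ((+) x ` Z)) \<longleftrightarrow>
   cube_interior F \<in> components (cube_interior Z)"
proof
  assume "cube_interior ((+) x ` F) \<in> components (cube_interior ((+) x ` Z))"
  from component_translation[OF this, of "real_point (-x)"]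
  show "cube_interior F \<in> components (cube_interior Z)"
    unfolding cube_interior_translation[symmetric] by (simp add: image_image)
next
  assume "cube_interior F \<in> components (cube_interior Z)"
  from component_translation[OF this, of "real_point x"]
  show "cube_interior ((+) x ` F) \<in> components (cube_interior ((+) x ` Z))"
    unfolding cube_interior_translation[symmetric] .
qed

lemma components_Union_components:
  assumes "\<C> \<subseteq> components T"
  shows "components (\<Union>\<C>) = \<C>"
proof
  have sub: "S \<in> components (\<Union>\<C>)" if "S \<in> \<C>" for S
    by (rule components_intermediate_subset[of _ T])
       (use that assms in \<open>auto dest: in_components_subset\<close>)
  then show "\<C> \<subseteq> components (\<Union>\<C>)" by blast
  show "components (\<Union>\<C>) \<subseteq> \<C>"
  proof
    fix S assume S: "S \<in> components (\<Union>\<C>)"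
    then obtain x where "x \<in> S" "x \<in> \<Union>\<C>"
      using in_components_nonempty in_components_subset by blast
    then obtain S' where "S' \<in> \<C>" "x \<in> S'" by blast
    then have "S = S'" using components_eq[OF S sub] \<open>x \<in> S\<close> by blast
    then show "S \<in> \<C>" using \<open>S' \<in> \<C>\<close> by simp
  qed
qed

section \<open>Clusters in the window and their shapes\<close>

definition clusters :: "(int ^ 'd) set \<Rightarrow> nat \<Rightarrow> (real ^ 'd) set set" where
  "clusters Z L = {S \<in> components (cube_interior Z). S \<subseteq> window L}"

definition sites :: "nat \<Rightarrow> (int ^ 'd) set" where
  "sites L = {z. \<forall>i. - \<lfloor>real L / 2\<rfloor> \<le> z $ i \<and> z $ i < \<lceil>real L / 2\<rceil>}"

text \<open>
  A canonical representative, containing the origin, of the translation class of a nonempty set.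
  The predicate under the choice operator is the same for all translates, which is what makes the
  representative canonical.
\<close>

definition shape_of :: "(int ^ 'd) set \<Rightarrow> (int ^ 'd) set" where
  "shape_of F = (SOME G. 0 \<in> G \<and> (\<exists>x. F = (+) x ` G))"

definition shapes :: "(int ^ 'd) set set" where
  "shapes = {F. finite F \<and> 0 \<in> F \<and> connected (cube_interior F) \<and> shape_of F = F}"

definition anchors :: "(int ^ 'd) set \<Rightarrow> nat \<Rightarrow> (int ^ 'd) set" where
  "anchors F L = {x. cube_interior ((+) x ` F) \<subseteq> window L}"

lemma int_box_eq_image:
  "{z :: int ^ 'd. \<forall>i. a \<le> z $ i \<and> z $ i < b} = vec_lambda ` (PiE UNIV (\<lambda>_. {a..<b}))"
proof (intro set_eqI iffI)
  fix z :: "int ^ 'd" assume "z \<in> {z. \<forall>i. a \<le> z $ i \<and> z $ i < b}"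
  then have "vec_lambda (\<lambda>i. z $ i) \<in> vec_lambda ` (PiE UNIV (\<lambda>_. {a..<b}))"
    by (intro imageI) auto
  then show "z \<in> vec_lambda ` (PiE UNIV (\<lambda>_. {a..<b}))" by simp
qed (auto simp: PiE_iff)

lemma finite_int_box [simp]: "finite {z :: int ^ 'd. \<forall>i. a \<le> z $ i \<and> z $ i < b}"
  unfolding int_box_eq_image by (intro finite_imageI finite_PiE) auto

lemma card_int_box: "card {z :: int ^ 'd. \<forall>i. a \<le> z $ i \<and> z $ i < b} = nat (b - a) ^ CARD('d)"
proof -
  have "inj_on (vec_lambda :: _ \<Rightarrow> int ^ 'd) (PiE UNIV (\<lambda>_. {a..<b}))"
    by (intro inj_onI) (metis vec_lambda_inverse UNIV_I)
  then show ?thesis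
    unfolding int_box_eq_image by (simp add: card_image card_PiE)
qed

lemma floor_half_add_ceiling_half: "\<lceil>real L / 2\<rceil> + \<lfloor>real L / 2\<rfloor> = int L"
proof -
  have "real_of_int (\<lceil>real L / 2\<rceil> + \<lfloor>real L / 2\<rfloor>) < real L + 1"
    "real_of_int (\<lceil>real L / 2\<rceil> + \<lfloor>real L / 2\<rfloor>) > real L - 1" by linarith+
  then show ?thesis by linarith
qed

lemma finite_sites [simp]: "finite (sites L)"
  by (simp add: sites_def)

lemma card_sites: "card (sites L :: (int ^ 'd) set) = L ^ CARD('d)"
  using floor_half_add_ceiling_half[of L] by (simp add: sites_def card_int_box)

lemma finite_neighbourhood:
  fixes F :: "(int ^ 'd) set"
  assumes "finite F" shows "finite (neighbourhood F)"
proof -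
  have "{z. \<forall>i. \<bar>z $ i - w $ i\<bar> \<le> 1} \<subseteq> (+) w ` {z :: int ^ 'd. \<forall>i. -1 \<le> z $ i \<and> z $ i < 2}" for w :: "int ^ 'd"
  proof
    fix z assume z: "z \<in> {z. \<forall>i. \<bar>z $ i - w $ i\<bar> \<le> 1}"
    have "-1 \<le> (z - w) $ i \<and> (z - w) $ i < 2" for i
      using z[THEN CollectD, rule_format, of i] unfolding vector_minus_component by linarith
    then show "z \<in> (+) w ` {z. \<forall>i. -1 \<le> z $ i \<and> z $ i < 2}"
      by (intro image_eqI[of _ _ "z - w"]) auto
  qed
  then have "finite {z. \<forall>i. \<bar>z $ i - w $ i\<bar> \<le> 1}" for w :: "int ^ 'd"
    by (rule finite_subset) (intro finite_imageI finite_int_box)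
  moreover have "neighbourhood F = (\<Union>w\<in>F. {z. \<forall>i. \<bar>z $ i - w $ i\<bar> \<le> 1})"
    by (auto simp: neighbourhood_def)
  ultimately show ?thesis using assms by simp
qed

lemma subset_neighbourhood: "F \<subseteq> neighbourhood F"
  by (force simp: neighbourhood_def)

lemma neighbourhood_mono: "F \<subseteq> G \<Longrightarrow> neighbourhood F \<subseteq> neighbourhood G"
  by (auto simp: neighbourhood_def)

lemma neighbourhood_translation: "neighbourhood ((+) x ` F) = (+) x ` neighbourhood F"
proof (intro set_eqI iffI)
  fix z assume "z \<in> neighbourhood ((+) x ` F)"
  then obtain w where w: "w \<in> F" "\<And>i. \<bar>z $ i - (x + w) $ i\<bar> \<le> 1" by (auto simp: neighbourhood_def)
  then have "z - x \<in> neighbourhood F"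
    by (auto simp: neighbourhood_def algebra_simps intro!: bexI[of _ w])
  then show "z \<in> (+) x ` neighbourhood F" by (intro image_eqI[of _ _ "z - x"]) auto
next
  fix z assume "z \<in> (+) x ` neighbourhood F"
  then obtain y w where "z = x + y" "w \<in> F" "\<And>i. \<bar>y $ i - w $ i\<bar> \<le> 1"
    by (auto simp: neighbourhood_def)
  then show "z \<in> neighbourhood ((+) x ` F)"
    by (auto simp: neighbourhood_def intro!: bexI[of _ w])
qed

lemma mem_window: "x \<in> window L \<longleftrightarrow>
   (\<forall>i. - real_of_int \<lfloor>real L / 2\<rfloor> \<le> x $ i \<and> x $ i \<le> real_of_int \<lceil>real L / 2\<rceil>)"
  by (simp add: window_def mem_box_cart)

lemma cells_window_subset:
  assumes "S \<subseteq> window L" shows "cells S \<subseteq> sites L"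
proof
  fix z assume "z \<in> cells S"
  then have *: "cube_center z \<in> window L" using assms by (auto simp: cells_def)
  have "- \<lfloor>real L / 2\<rfloor> \<le> z $ i \<and> z $ i < \<lceil>real L / 2\<rceil>" for i
  proof -
    have "- real_of_int \<lfloor>real L / 2\<rfloor> \<le> real_of_int (z $ i) + 1/2"
      "real_of_int (z $ i) + 1/2 \<le> real_of_int \<lceil>real L / 2\<rceil>"
      using * by (auto simp: mem_window cube_center_def)
    then show ?thesis by linarith
  qed
  then show "z \<in> sites L" by (simp add: sites_def)
qed

lemma clusterD:
  assumes "S \<in> clusters Z L"
  shows "S \<in> components (cube_interior Z)" "S \<subseteq> window L" "S = cube_interior (cells S)"
    "cells S \<subseteq> sites L" "finite (cells S)" "cells S \<noteq> {}" "connected S"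
proof -
  show S: "S \<in> components (cube_interior Z)" and w: "S \<subseteq> window L"
    using assms by (auto simp: clusters_def)
  show eq: "S = cube_interior (cells S)" by (rule component_eq_cube_interior[OF S])
  show sub: "cells S \<subseteq> sites L" by (rule cells_window_subset[OF w])
  show "finite (cells S)" using sub finite_sites finite_subset by blast
  have "S \<noteq> {}" "connected S" using S in_components_nonempty in_components_connected by blast+
  then show "cells S \<noteq> {}" "connected S" using eq by (auto simp: cube_interior_def)
qed

lemma cluster_mem_cubical_complexes:
  assumes "S \<in> clusters Z L" shows "S \<in> cubical_complexes"
  using clusterD(1,3,5,7)[OF assms] in_components_nonempty unfolding cubical_complexes_def by blast

lemma finite_clusters [simp]: "finite (clusters Z L)"
proof (rule finite_subset)
  show "clusters Z L \<subseteq> cube_interior ` Pow (sites L)"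
    using clusterD(3,4) by blast
qed simp

lemma components_Phi_window: "components (Phi_window Z L) = clusters Z L"
  unfolding Phi_window_def clusters_def by (rule components_Union_components) blast

text \<open>
  This makes every function of \<open>Phi_window Z L\<close> a function of finitely many colours, and thereby
  measurable.
\<close>

lemma Phi_window_local:
  assumes "Z \<inter> neighbourhood (sites L) = Z' \<inter> neighbourhood (sites L)"
  shows "Phi_window Z L = Phi_window Z' L"
proof -
  have *: "S \<in> clusters X' L" if "S \<in> clusters X L"
    "X \<inter> neighbourhood (sites L) = X' \<inter> neighbourhood (sites L)" for S X X'
  proof -
    note S = clusterD[OF that(1)]
    have "X \<inter> neighbourhood (cells S) = X' \<inter> neighbourhood (cells S)"
      using neighbourhood_mono[OF S(4)] that(2) by blast
    from component_local[OF S(5) this] show ?thesis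
      using S by (auto simp: clusters_def)
  qed
  have "clusters Z L = clusters Z' L" using *[of _ Z Z'] *[of _ Z' Z] assms by auto
  then show ?thesis by (simp add: Phi_window_def clusters_def)
qed

lemma shape_of_translation: "shape_of ((+) x ` F) = shape_of F"
proof -
  have "(\<exists>y. (+) x ` F = (+) y ` G) \<longleftrightarrow> (\<exists>y. F = (+) y ` G)" for G
  proof
    assume "\<exists>y. (+) x ` F = (+) y ` G"
    then obtain y where "(+) x ` F = (+) y ` G" by blast
    then have "(+) (-x) ` (+) x ` F = (+) (-x) ` (+) y ` G" by simp
    then have "F = (+) (y - x) ` G" by (simp add: image_image algebra_simps)
    then show "\<exists>y. F = (+) y ` G" by blast
  next
    assume "\<exists>y. F = (+) y ` G"
    then obtain y where "F = (+) y ` G" by blast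
    then have "(+) x ` F = (+) (x + y) ` G" by (simp add: image_image algebra_simps)
    then show "\<exists>y. (+) x ` F = (+) y ` G" by blast
  qed
  then show ?thesis by (simp add: shape_of_def)
qed

lemma shape_of_props:
  assumes "F \<noteq> {}"
  shows "0 \<in> shape_of F" "\<exists>x. F = (+) x ` shape_of F"
proof -
  obtain x where "x \<in> F" using assms by blast
  then have "0 \<in> (+) (-x) ` F" by force
  moreover have "F = (+) x ` (+) (-x) ` F" by (simp add: image_image)
  ultimately have "\<exists>G. 0 \<in> G \<and> (\<exists>x. F = (+) x ` G)" by blast
  from someI_ex[OF this] show "0 \<in> shape_of F" "\<exists>x. F = (+) x ` shape_of F"
    by (auto simp: shape_of_def)
qed

lemma shape_of_mem_shapes:
  assumes "finite F" "F \<noteq> {}" "connected (cube_interior F)"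
  shows "shape_of F \<in> shapes"
proof -
  obtain x where x: "F = (+) x ` shape_of F" using shape_of_props assms by blast
  then have inv: "shape_of F = (+) (-x) ` F" 
  proof -
    have "(+) (-x) ` F = (+) (-x) ` (+) x ` shape_of F" using x by simp
    then show ?thesis by (simp add: image_image)
  qed
  have "finite (shape_of F)" unfolding inv using assms by simp
  moreover have "connected (cube_interior (shape_of F))"
    unfolding inv cube_interior_translation
    by (intro connected_continuous_image continuous_intros assms)
  moreover have "shape_of (shape_of F) = shape_of F"
    using shape_of_translation[of "-x" F] inv by simp
  ultimately show ?thesis using shape_of_props assms by (simp add: shapes_def)
qed

lemma countable_shapes: "countable shapes"
  by (rule countable_subset[OF _ countable_Collect_finite]) (auto simp: shapes_def)

text \<open>
  Summing the coordinates over the finite set shows that no nonzero translation preserves it.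
  Hence a cluster has exactly one anchor.
\<close>

lemma translation_eq_self_finite:
  fixes x y :: "int ^ 'd"
  assumes "finite F" "F \<noteq> {}" "(+) x ` F = (+) y ` F"
  shows "x = y"
proof -
  have sum: "(\<Sum>z\<in>(+) u ` F. z $ i) = int (card F) * (u $ i) + (\<Sum>z\<in>F. z $ i)" for u :: "int ^ 'd" and i
    by (subst sum.reindex) (auto simp: sum.distrib)
  have "x $ i = y $ i" for i
    using sum[of i x] sum[of i y] assms by auto
  then show ?thesis by (simp add: vec_eq_iff)
qed

text \<open>
  Turns the number of clusters of a given shape into a sum over lattice positions, to which a
  second moment estimate applies.
\<close>

lemma clusters_of_shape:
  assumes "F \<in> shapes"
  shows "bij_betw (\<lambda>x. cube_interior ((+) x ` F))
           {x \<in> anchors F L. cube_interior ((+) x ` F) \<in> components (cube_interior Z)}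
           {S \<in> clusters Z L. shape_of (cells S) = F}"
  unfolding bij_betw_def
proof
  have F: "finite F" "F \<noteq> {}" "shape_of F = F" using assms by (auto simp: shapes_def)
  show "inj_on (\<lambda>x. cube_interior ((+) x ` F))
     {x \<in> anchors F L. cube_interior ((+) x ` F) \<in> components (cube_interior Z)}"
    by (intro inj_onI) (metis F(1,2) cells_cube_interior translation_eq_self_finite)
  show "(\<lambda>x. cube_interior ((+) x ` F)) `
     {x \<in> anchors F L. cube_interior ((+) x ` F) \<in> components (cube_interior Z)} =
     {S \<in> clusters Z L. shape_of (cells S) = F}"
  proof (intro equalityI subsetI)
    fix S assume S: "S \<in> {S \<in> clusters Z L. shape_of (cells S) = F}"
    then obtain x where x: "cells S = (+) x ` F"
      using shape_of_props(2)[of "cells S"] clusterD(6)[of S Z L] by auto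
    then have "S = cube_interior ((+) x ` F)" using clusterD(3)[of S Z L] S by simp
    then show "S \<in> (\<lambda>x. cube_interior ((+) x ` F)) `
     {x \<in> anchors F L. cube_interior ((+) x ` F) \<in> components (cube_interior Z)}"
      using S by (auto simp: anchors_def clusters_def)
  qed (auto simp: anchors_def clusters_def shape_of_translation F)
qed

lemma anchors_subset_sites:
  assumes "0 \<in> F" shows "anchors F L \<subseteq> sites L"
proof
  fix x assume "x \<in> anchors F L"
  then have "(+) x ` F \<subseteq> sites L"
    using cells_window_subset[of "cube_interior ((+) x ` F)" L] by (simp add: anchors_def)
  then show "x \<in> sites L" using assms by force
qed

lemma finite_anchors: "0 \<in> F \<Longrightarrow> finite (anchors F L)"
  using anchors_subset_sites finite_sites finite_subset by blast

text \<open>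
  If all coordinates in \<open>F\<close> are at most \<open>m\<close> in absolute value, every position at distance more than \<open>m\<close> from
  the boundary of the window is an anchor, so \<open>k = 2 * m\<close> works.
\<close>

lemma card_anchors_lower:
  fixes F :: "(int ^ 'd) set"
  assumes "finite F" "0 \<in> F"
  shows "\<exists>k. \<forall>L. (L - k) ^ CARD('d) \<le> card (anchors F L)"
proof -
  have "\<exists>m. \<forall>z\<in>F. \<forall>i. \<bar>z $ i\<bar> \<le> int m"
  proof -
    have "\<bar>z $ i\<bar> \<le> (\<Sum>z\<in>F. \<Sum>i\<in>UNIV. \<bar>z $ i\<bar>)" if "z \<in> F" for z i
    proof -
      have "\<bar>z $ i\<bar> \<le> (\<Sum>i\<in>UNIV. \<bar>z $ i\<bar>)" by (rule member_le_sum) auto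
      also have "\<dots> \<le> (\<Sum>z\<in>F. \<Sum>i\<in>UNIV. \<bar>z $ i\<bar>)"
        using that assms by (intro member_le_sum) (auto intro: sum_nonneg)
      finally show ?thesis .
    qed
    then show ?thesis by (intro exI[of _ "nat (\<Sum>z\<in>F. \<Sum>i\<in>UNIV. \<bar>z $ i\<bar>)"]) fastforce
  qed
  then obtain m where m: "\<And>z i. z \<in> F \<Longrightarrow> \<bar>z $ i\<bar> \<le> int m" by blast
  have "(L - 2 * m) ^ CARD('d) \<le> card (anchors F L)" for L
  proof -
    let ?B = "{x :: int ^ 'd. \<forall>i. int m - \<lfloor>real L / 2\<rfloor> \<le> x $ i \<and> x $ i < \<lceil>real L / 2\<rceil> - int m}"
    have "?B \<subseteq> anchors F L"
    proof
      fix x assume x: "x \<in> ?B"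
      have "y \<in> window L" if "z \<in> F" "y \<in> lattice_cube 1 (x + z)" for y z
        unfolding mem_window
      proof
        fix i
        have "real_of_int (x $ i + z $ i) \<le> y $ i" "y $ i \<le> real_of_int (x $ i + z $ i) + 1"
          using that(2) by (auto simp: mem_lattice_cube)
        moreover have "int m - \<lfloor>real L / 2\<rfloor> \<le> x $ i" "x $ i < \<lceil>real L / 2\<rceil> - int m" using x by auto
        moreover have "\<bar>z $ i\<bar> \<le> int m" using m that by blast
        ultimately show "- real_of_int \<lfloor>real L / 2\<rfloor> \<le> y $ i \<and> y $ i \<le> real_of_int \<lceil>real L / 2\<rceil>"
          by linarith
      qed
      then have "(\<Union>z\<in>(+) x ` F. lattice_cube 1 z) \<subseteq> window L" by auto
      then show "x \<in> anchors F L"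
        using cube_interior_subset[of "(+) x ` F"] by (auto simp: anchors_def)
    qed
    then have "card ?B \<le> card (anchors F L)"
      by (intro card_mono finite_anchors assms)
    moreover have "nat (\<lceil>real L / 2\<rceil> - int m - (int m - \<lfloor>real L / 2\<rfloor>)) = L - 2 * m"
      using floor_half_add_ceiling_half[of L] by linarith
    ultimately show ?thesis by (simp add: card_int_box)
  qed
  then show ?thesis by blast
qed

lemma card_anchors_asymp:
  fixes F :: "(int ^ 'd) set"
  assumes "finite F" "0 \<in> F"
  shows "(\<lambda>L. real (card (anchors F L)) / real (L ^ CARD('d))) \<longlonglongrightarrow> 1"
proof -
  obtain k where k: "\<And>L. (L - k) ^ CARD('d) \<le> card (anchors F L)"
    using card_anchors_lower[OF assms] by blast
  have up: "card (anchors F L) \<le> L ^ CARD('d)" for L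
    using card_mono[OF finite_sites anchors_subset_sites[OF assms(2)]] card_sites[where 'd='d] by metis
  have "(\<lambda>L. 1 - real k / real L) \<longlonglongrightarrow> 1 - 0"
    by (intro tendsto_intros lim_const_over_n)
  then have "(\<lambda>L. (1 - real k / real L) ^ CARD('d)) \<longlonglongrightarrow> 1 ^ CARD('d)"
    by (intro tendsto_power) simp
  then have lim: "(\<lambda>L. (1 - real k / real L) ^ CARD('d)) \<longlonglongrightarrow> 1" by simp
  show ?thesis
  proof (rule tendsto_sandwich[OF _ _ lim tendsto_const])
    show "\<forall>\<^sub>F L in sequentially.
       (1 - real k / real L) ^ CARD('d) \<le> real (card (anchors F L)) / real (L ^ CARD('d))"
      using eventually_gt_at_top[of k]
    proof eventually_elim
      case (elim L)
      have "(1 - real k / real L) ^ CARD('d) = real ((L - k) ^ CARD('d)) / real (L ^ CARD('d))"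
        using elim by (simp add: power_divide[symmetric] diff_divide_distrib of_nat_diff)
      also have "\<dots> \<le> real (card (anchors F L)) / real (L ^ CARD('d))"
        using k[of L] by (intro divide_right_mono) (simp_all only: of_nat_le_iff of_nat_0_le_iff)
      finally show ?case .
    qed
    show "\<forall>\<^sub>F L in sequentially. real (card (anchors F L)) / real (L ^ CARD('d)) \<le> 1"
      using up by (auto intro!: always_eventually simp: divide_le_eq_1 simp flip: of_nat_power)
  qed
qed

section \<open>Homotopy types and the empirical measure\<close>

lemma homotopy_rel_equiv: "equiv cubical_complexes homotopy_rel"
proof (rule equivI)
  show "refl_on cubical_complexes homotopy_rel"
    by (auto simp: refl_on_def homotopy_rel_def homotopy_equivalent_space_refl)
  show "sym homotopy_rel"
    by (auto simp: sym_def homotopy_rel_def intro: homotopy_equivalent_space_sym[THEN iffD1])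
  show "trans homotopy_rel"
    by (auto simp: trans_def homotopy_rel_def intro: homotopy_eqv_trans)
qed (auto simp: homotopy_rel_def)

lemma homotopy_type_mem: "S \<in> cubical_complexes \<Longrightarrow> homotopy_type S \<in> homotopy_types"
  by (simp add: homotopy_type_def homotopy_types_def quotientI)

lemma homotopy_type_translation:
  assumes "cube_interior F \<in> cubical_complexes" "cube_interior ((+) x ` F) \<in> cubical_complexes"
  shows "homotopy_type (cube_interior ((+) x ` F)) = homotopy_type (cube_interior F)"
  unfolding homotopy_type_def
proof (rule equiv_class_eq[OF homotopy_rel_equiv])
  show "(cube_interior ((+) x ` F), cube_interior F) \<in> homotopy_rel"
    using assms homotopy_eqv_translation[of "real_point x" "cube_interior F"]
    by (simp add: homotopy_rel_def cube_interior_translation)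
qed

definition shape_type :: "(int ^ 'd) set \<Rightarrow> (real ^ 'd) set set" where
  "shape_type F = homotopy_type (cube_interior F)"

lemma cube_interior_nonempty_iff: "cube_interior F \<noteq> {} \<longleftrightarrow> F \<noteq> {}"
  using cube_center_mem_iff[of _ F] cube_interior_subset[of F] by blast

lemma shape_type_mem: "F \<in> shapes \<Longrightarrow> shape_type F \<in> homotopy_types"
  unfolding shape_type_def
  by (intro homotopy_type_mem) (auto simp: cubical_complexes_def cube_interior_nonempty_iff shapes_def)

lemma shape_of_complex:
  assumes "finite F" "cube_interior F \<in> cubical_complexes"
  shows "shape_of F \<in> shapes" "shape_type (shape_of F) = homotopy_type (cube_interior F)"
proof -
  have F: "F \<noteq> {}" "connected (cube_interior F)"
    using assms by (auto simp: cubical_complexes_def cube_interior_nonempty_iff)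
  show sh: "shape_of F \<in> shapes" by (rule shape_of_mem_shapes[OF assms(1) F])
  obtain x where x: "F = (+) x ` shape_of F" using shape_of_props[OF F(1)] by blast
  have "cube_interior (shape_of F) \<in> cubical_complexes"
    using sh by (auto simp: cubical_complexes_def cube_interior_nonempty_iff shapes_def)
  then have "homotopy_type (cube_interior ((+) x ` shape_of F)) = homotopy_type (cube_interior (shape_of F))"
    by (rule homotopy_type_translation) (use assms x[symmetric] in simp)
  then show "shape_type (shape_of F) = homotopy_type (cube_interior F)"
    unfolding x[symmetric] by (simp add: shape_type_def)
qed

lemma cluster_shape:
  assumes "S \<in> clusters Z L"
  shows "shape_of (cells S) \<in> shapes" "homotopy_type S = shape_type (shape_of (cells S))"
  using shape_of_complex[of "cells S"] clusterD(5)[OF assms] clusterD(3)[OF assms, symmetric]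
    cluster_mem_cubical_complexes[OF assms] by simp_all

lemma homotopy_types_eq: "homotopy_types = shape_type ` shapes"
proof
  show "homotopy_types \<subseteq> shape_type ` shapes"
  proof
    fix \<gamma> assume "\<gamma> \<in> (homotopy_types :: (real ^ 'd) set set set)"
    then obtain S :: "(real ^ 'd) set" where S: "S \<in> cubical_complexes" "\<gamma> = homotopy_type S"
      by (auto simp: homotopy_types_def homotopy_type_def elim: quotientE)
    then obtain F where "finite F" "S = cube_interior F" by (auto simp: cubical_complexes_def)
    then show "\<gamma> \<in> shape_type ` shapes" using shape_of_complex[of F] S by auto
  qed
qed (auto intro: shape_type_mem)

text \<open>
  The explicit set function in the definition agrees with the image of the uniform distribution on
  the clusters, so it is countably additive and the extension by \<open>measure_of\<close> keeps its values.
\<close>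

lemma empirical_measure_props:
  fixes Z :: "(int ^ 'd) set"
  assumes "clusters Z L \<noteq> {}"
  shows "sets (empirical_measure \<nu> Z L) = Pow homotopy_types"
    and "A \<subseteq> homotopy_types \<Longrightarrow> measure (empirical_measure \<nu> Z L) A =
      real (card {S \<in> clusters Z L. shape_type (shape_of (cells S)) \<in> A}) / real (card (clusters Z L))"
proof -
  let ?C = "clusters Z L" let ?f = "\<lambda>S. shape_type (shape_of (cells S))"
  define N where "N = distr (uniform_count_measure ?C) (count_space homotopy_types) ?f"
  have f: "?f \<in> ?C \<rightarrow> homotopy_types" using cluster_shape(1) shape_type_mem by blast
  have meas: "?f \<in> measurable (uniform_count_measure ?C) (count_space homotopy_types)"
    using f by (auto simp: measurable_def sets_uniform_count_measure space_uniform_count_measure)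
  have c: "card ?C > 0" using assms by (simp add: card_gt_0_iff)
  have emN: "emeasure N A = ennreal (real (card {S \<in> ?C. ?f S \<in> A}) / real (card ?C))"
    if "A \<subseteq> homotopy_types" for A
  proof -
    have "?f -` A \<inter> space (uniform_count_measure ?C) = {S \<in> ?C. ?f S \<in> A}"
      by (auto simp: space_uniform_count_measure)
    then show ?thesis
      unfolding N_def using that by (subst emeasure_distr[OF meas]) (auto simp: emeasure_uniform_count_measure)
  qed
  have "empirical_measure \<nu> Z L = measure_of homotopy_types (Pow homotopy_types)
             (\<lambda>A. (\<Sum>s\<in>?C. indicator A (homotopy_type s)) / ennreal (real (card ?C)))"
    using assms by (simp add: empirical_measure_def b0_def components_Phi_window)
  also have "\<dots> = measure_of homotopy_types (Pow homotopy_types) (emeasure N)"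
  proof (rule measure_of_eq)
    fix A assume "A \<in> sigma_sets homotopy_types (Pow homotopy_types :: (real ^ 'd) set set set set)"
    then have A: "A \<subseteq> homotopy_types" using sigma_sets_into_sp by blast
    have "(\<Sum>s\<in>?C. indicator A (homotopy_type s) :: ennreal) = (\<Sum>s\<in>?C. if ?f s \<in> A then 1 else 0)"
      by (intro sum.cong) (auto simp: indicator_def cluster_shape(2)[of _ Z L])
    also have "\<dots> = of_nat (card {S \<in> ?C. ?f S \<in> A})"
      by (subst sum.inter_filter[symmetric]) auto
    finally show "(\<Sum>s\<in>?C. indicator A (homotopy_type s)) / ennreal (real (card ?C)) = emeasure N A"
      using c by (simp add: emN[OF A] divide_ennreal ennreal_of_nat_eq_real_of_nat)
  qed simp
  also have "\<dots> = N"
    using measure_of_of_measure[of N] by (simp add: N_def)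
  finally have eq: "empirical_measure \<nu> Z L = N" .
  show "sets (empirical_measure \<nu> Z L) = Pow homotopy_types" by (simp add: eq N_def)
  show "measure (empirical_measure \<nu> Z L) A = real (card {S \<in> ?C. ?f S \<in> A}) / real (card ?C)"
    if "A \<subseteq> homotopy_types" using emN[OF that] by (simp add: eq measure_def)
qed

lemma empirical_measure_default:
  "clusters Z L = {} \<Longrightarrow> empirical_measure \<nu> Z L = \<nu>"
  by (simp add: empirical_measure_def b0_def components_Phi_window)

lemma empirical_measure_local:
  assumes "Z \<inter> neighbourhood (sites L) = Z' \<inter> neighbourhood (sites L)"
  shows "empirical_measure \<nu> Z L = empirical_measure \<nu> Z' L"
  by (simp add: empirical_measure_def Phi_window_local[OF assms])

section \<open>Comparing frequencies with densities\<close>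

lemma integrable_count_space_finite_support:
  fixes f :: "'a \<Rightarrow> real"
  assumes "finite {x \<in> A. f x \<noteq> 0}"
  shows "integrable (count_space A) f"
proof -
  have "integrable (count_space A) f \<longleftrightarrow> integrable (count_space A) (\<lambda>x. \<Sum>y\<in>{x \<in> A. f x \<noteq> 0}. f y * indicator {y} x)"
  proof (rule Bochner_Integration.integrable_cong)
    fix x assume x: "x \<in> space (count_space A)"
    have "(\<Sum>y\<in>{x \<in> A. f x \<noteq> 0}. f y * indicator {y} x) = (\<Sum>y\<in>{x \<in> A. f x \<noteq> 0}. if y = x then f y else 0)"
      by (intro sum.cong) (auto simp: indicator_def)
    also have "\<dots> = f x" using assms x by (simp add: sum.delta')
    finally show "f x = (\<Sum>y\<in>{x \<in> A. f x \<noteq> 0}. f y * indicator {y} x)" by simp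
  qed simp
  also have "\<dots>" by (intro Bochner_Integration.integrable_sum integrable_mult_right integrable_real_indicator) auto
  finally show ?thesis .
qed

text \<open>
  Counting the points of \<open>C\<close> fibre by fibre. Writing the count as an integral over all of \<open>R\<close> allows
  a comparison with the density \<open>q\<close> by integral inequalities.
\<close>

lemma integral_fibre_cards:
  assumes "finite C" "g ` C \<subseteq> R"
  shows "integrable (count_space R) (\<lambda>F. real (card {s \<in> C. g s = F}) * indicator B F)"
    and "(\<integral>F. real (card {s \<in> C. g s = F}) * indicator B F \<partial>count_space R) = real (card {s \<in> C. g s \<in> B})"
proof -
  let ?N = "\<lambda>F. real (card {s \<in> C. g s = F}) * indicator B F :: real"
  have sup: "{F \<in> R. ?N F \<noteq> 0} \<subseteq> g ` {s \<in> C. g s \<in> B}"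
    by (auto simp: card_eq_0_iff indicator_def)
  have fin: "finite {F \<in> R. ?N F \<noteq> 0}" by (rule finite_subset[OF sup]) (use assms in simp)
  show "integrable (count_space R) ?N" by (rule integrable_count_space_finite_support[OF fin])
  have "(\<integral>F. ?N F \<partial>count_space R) = (\<Sum>F\<in>{F \<in> R. ?N F \<noteq> 0}. ?N F)"
    by (rule lebesgue_integral_count_space_finite_support[OF fin])
  also have "\<dots> = (\<Sum>F\<in>g ` {s \<in> C. g s \<in> B}. ?N F)"
    using assms sup by (intro sum.mono_neutral_left) auto
  also have "\<dots> = (\<Sum>F\<in>g ` {s \<in> C. g s \<in> B}. \<Sum>s | s \<in> {s \<in> C. g s \<in> B} \<and> g s = F. 1)"
    by (intro sum.cong) (auto intro!: arg_cong[of _ _ card])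
  also have "\<dots> = (\<Sum>s\<in>{s \<in> C. g s \<in> B}. 1)"
    using assms by (intro sum.image_gen[symmetric]) simp
  finally show "(\<integral>F. ?N F \<partial>count_space R) = real (card {s \<in> C. g s \<in> B})" by simp
qed

text \<open>
  From \<open>a / b - c / d = ((a - c) - (a / b) * (b - d)) / d\<close> with \<open>a / b \<le> 1\<close>: only the deterministic
  denominator \<open>d\<close> needs to be bounded away from zero.
\<close>

lemma ratio_diff_le:
  fixes a b c d :: real
  assumes "0 \<le> a" "a \<le> b" "0 < b" "0 < d" "\<bar>a - c\<bar> \<le> e" "\<bar>b - d\<bar> \<le> e"
  shows "\<bar>a / b - c / d\<bar> \<le> 2 * e / d"
proof -
  have "a / b - c / d = ((a - c) - (a / b) * (b - d)) / d"
    using assms by (simp add: field_simps)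
  moreover have "\<bar>(a - c) - (a / b) * (b - d)\<bar> \<le> \<bar>a - c\<bar> + \<bar>a / b\<bar> * \<bar>b - d\<bar>"
    by (metis abs_mult abs_triangle_ineq4)
  moreover have "\<bar>a / b\<bar> * \<bar>b - d\<bar> \<le> 1 * \<bar>b - d\<bar>"
    using assms by (intro mult_right_mono) (auto simp: divide_le_eq_1)
  ultimately show ?thesis using assms by (simp add: abs_divide divide_right_mono)
qed

text \<open>
  If the fibre counts divided by \<open>n\<close> are close to \<open>q\<close> in \<open>\<ell>\<^sup>1\<close>, then the empirical frequencies are close
  to the normalised \<open>q\<close>, uniformly in the set \<open>B\<close>. The bound is what makes convergence in total variation
  no harder than convergence in \<open>\<ell>\<^sup>1\<close> of the counts.
\<close>

lemma frequency_deviation_le: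
  fixes q :: "'b \<Rightarrow> real" and n :: real
  assumes "finite C" "C \<noteq> {}" "g ` C \<subseteq> R" "n > 0"
    and q: "integrable (count_space R) q" and Q: "(\<integral>F. q F \<partial>count_space R) > 0"
  defines "D \<equiv> \<integral>F. \<bar>real (card {s \<in> C. g s = F}) / n - q F\<bar> \<partial>count_space R"
  shows "\<bar>real (card {s \<in> C. g s \<in> B}) / real (card C) -
          (\<integral>F. q F * indicator B F \<partial>count_space R) / (\<integral>F. q F \<partial>count_space R)\<bar>
         \<le> 2 * D / (\<integral>F. q F \<partial>count_space R)"
proof -
  let ?u = "\<lambda>F. real (card {s \<in> C. g s = F}) / n"
  note fib = integral_fibre_cards[OF assms(1,3)]
  have u: "integrable (count_space R) ?u"
    using fib(1)[of UNIV] by simp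
  have qB: "integrable (count_space R) (\<lambda>F. q F * indicator B F)" for B
    by (rule Bochner_Integration.integrable_bound[OF q]) (auto simp: indicator_def)
  have uB: "integrable (count_space R) (\<lambda>F. ?u F * indicator B F)" for B
    by (rule Bochner_Integration.integrable_bound[OF u]) (auto simp: indicator_def)
  have iu: "(\<integral>F. ?u F * indicator B F \<partial>count_space R) = real (card {s \<in> C. g s \<in> B}) / n" for B
    using fib(2)[of B] by simp
  have dev: "\<bar>real (card {s \<in> C. g s \<in> B}) / n - (\<integral>F. q F * indicator B F \<partial>count_space R)\<bar> \<le> D" for B
  proof -
    have "real (card {s \<in> C. g s \<in> B}) / n - (\<integral>F. q F * indicator B F \<partial>count_space R)
        = (\<integral>F. (?u F * indicator B F - q F * indicator B F) \<partial>count_space R)"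
      unfolding iu[symmetric] using uB qB by (rule Bochner_Integration.integral_diff[symmetric])
    also have "\<bar>\<dots>\<bar> \<le> (\<integral>F. \<bar>?u F * indicator B F - q F * indicator B F\<bar> \<partial>count_space R)"
      by (rule integral_abs_bound)
    also have "\<dots> \<le> D" unfolding D_def
      using u q uB qB by (intro integral_mono integrable_abs Bochner_Integration.integrable_diff) (auto simp: indicator_def)
    finally show ?thesis .
  qed
  have c: "card C > 0" using assms by (simp add: card_gt_0_iff)
  have "\<bar>(real (card {s \<in> C. g s \<in> B}) / n) / (real (card C) / n) -
          (\<integral>F. q F * indicator B F \<partial>count_space R) / (\<integral>F. q F \<partial>count_space R)\<bar>
         \<le> 2 * D / (\<integral>F. q F \<partial>count_space R)"
  proof (rule ratio_diff_le)
    show "real (card {s \<in> C. g s \<in> B}) / n \<le> real (card C) / n"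
      using assms by (intro divide_right_mono) (auto intro!: card_mono)
    show "\<bar>real (card C) / n - (\<integral>F. q F \<partial>count_space R)\<bar> \<le> D"
      using dev[of UNIV] by simp
  qed (use assms c dev in auto)
  then show ?thesis using \<open>n > 0\<close> by simp
qed

section \<open>The limit law\<close>

text \<open>
  With the densities of the shapes for \<open>q\<close>, this is the limit of the empirical measures.
\<close>

definition type_law :: "((int ^ 'd) set \<Rightarrow> real) \<Rightarrow> (real ^ 'd) set set measure" where
  "type_law q = distr (density (count_space shapes) (\<lambda>F. ennreal (q F / (\<integral>F. q F \<partial>count_space shapes))))
     (count_space homotopy_types) shape_type"

lemma sets_type_law [simp]: "sets (type_law q) = Pow homotopy_types"
  by (simp add: type_law_def)

lemma emeasure_type_law:
  fixes q :: "(int ^ 'd) set \<Rightarrow> real"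
  assumes q: "integrable (count_space shapes) q" "\<And>F. F \<in> shapes \<Longrightarrow> 0 \<le> q F"
    and Q: "(\<integral>F. q F \<partial>count_space shapes) > 0" and A: "A \<subseteq> homotopy_types"
  shows "emeasure (type_law q) A =
    ennreal ((\<integral>F. q F * indicator (shape_type -` A) F \<partial>count_space shapes) / (\<integral>F. q F \<partial>count_space shapes))"
proof -
  let ?Q = "\<integral>F. q F \<partial>count_space (shapes :: (int ^ 'd) set set)"
  let ?D = "density (count_space shapes) (\<lambda>F. ennreal (q F / ?Q))"
  have meas: "shape_type \<in> measurable ?D (count_space homotopy_types)"
    by (auto simp: measurable_def shape_type_mem)
  have qB: "integrable (count_space shapes) (\<lambda>F. q F * indicator B F)" for B
    by (rule Bochner_Integration.integrable_bound[OF q(1)]) (auto simp: indicator_def)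
  have "emeasure (type_law q) A = emeasure ?D (shape_type -` A \<inter> shapes)"
    unfolding type_law_def using A by (subst emeasure_distr[OF meas]) auto
  also have "\<dots> = (\<integral>\<^sup>+F. ennreal (q F / ?Q) * indicator (shape_type -` A \<inter> shapes) F \<partial>count_space shapes)"
    by (rule emeasure_density) auto
  also have "\<dots> = (\<integral>\<^sup>+F. ennreal (q F * indicator (shape_type -` A) F / ?Q) \<partial>count_space shapes)"
    by (intro nn_integral_cong) (auto simp: indicator_def)
  also have "\<dots> = ennreal (\<integral>F. q F * indicator (shape_type -` A) F / ?Q \<partial>count_space shapes)"
    using q(2) Q qB by (intro nn_integral_eq_integral) (auto simp: AE_count_space)
  finally show ?thesis by simp
qed

lemma measure_type_law:
  fixes q :: "(int ^ 'd) set \<Rightarrow> real"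
  assumes q: "integrable (count_space shapes) q" "\<And>F. F \<in> shapes \<Longrightarrow> 0 \<le> q F"
    and Q: "(\<integral>F. q F \<partial>count_space shapes) > 0" and A: "A \<subseteq> homotopy_types"
  shows "measure (type_law q) A =
    (\<integral>F. q F * indicator (shape_type -` A) F \<partial>count_space shapes) / (\<integral>F. q F \<partial>count_space shapes)"
proof -
  have "(\<integral>F. q F * indicator (shape_type -` A) F \<partial>count_space shapes) \<ge> 0"
    using q by (intro integral_nonneg_AE) (auto simp: AE_count_space)
  then show ?thesis using emeasure_type_law[OF assms] Q by (simp add: measure_def)
qed

lemma prob_space_type_law:
  fixes q :: "(int ^ 'd) set \<Rightarrow> real"
  assumes q: "integrable (count_space shapes) q" "\<And>F. F \<in> shapes \<Longrightarrow> 0 \<le> q F"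
    and Q: "(\<integral>F. q F \<partial>count_space shapes) > 0"
  shows "prob_space (type_law q)"
proof (rule prob_spaceI)
  have sp: "space (type_law q) = homotopy_types" by (simp add: type_law_def)
  have "(\<integral>F. q F * indicator (shape_type -` homotopy_types) F \<partial>count_space shapes) = (\<integral>F. q F \<partial>count_space shapes)"
    by (intro Bochner_Integration.integral_cong) (auto simp: indicator_def shape_type_mem)
  then show "emeasure (type_law q) (space (type_law q)) = 1"
    unfolding sp using emeasure_type_law[OF assms order_refl] Q by simp
qed

text \<open>
  Every type is realised by some shape, and a single shape already carries positive mass.
\<close>

lemma type_law_pos:
  fixes q :: "(int ^ 'd) set \<Rightarrow> real"
  assumes q: "integrable (count_space shapes) q" "\<And>F. F \<in> shapes \<Longrightarrow> 0 < q F"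
    and Q: "(\<integral>F. q F \<partial>count_space shapes) > 0" and \<gamma>: "\<gamma> \<in> homotopy_types"
  shows "measure (type_law q) {\<gamma>} > 0"
proof -
  obtain G where G: "G \<in> shapes" "\<gamma> = shape_type G" using \<gamma> by (auto simp: homotopy_types_eq)
  have qB: "integrable (count_space shapes) (\<lambda>F. q F * indicator B F)" for B
    by (rule Bochner_Integration.integrable_bound[OF q(1)]) (auto simp: indicator_def)
  have "0 < q G" using q G by blast
  also have "q G = (\<integral>F. q F * indicator {G} F \<partial>count_space shapes)"
  proof -
    have "{F \<in> shapes. q F * indicator {G} F \<noteq> 0} = {G}"
      using G q(2)[of G] by (auto simp: indicator_def)
    then show ?thesis by (subst lebesgue_integral_count_space_finite_support) auto
  qed
  also have "\<dots> \<le> (\<integral>F. q F * indicator (shape_type -` {\<gamma>}) F \<partial>count_space shapes)"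
    by (intro integral_mono qB) (auto simp: indicator_def G less_imp_le q(2))
  finally show ?thesis
    using measure_type_law[OF q(1) _ Q, of "{\<gamma>}"] q(2) Q \<gamma> by (simp add: less_imp_le)
qed

text \<open>
  When the window contains no cluster all counts vanish, the integral on the right equals the total
  density, and the bound becomes the trivial estimate by 2. So one estimate covers both cases of the
  definition of the empirical measure.
\<close>

lemma tv_dist_empirical_le:
  fixes q :: "(int ^ 'd) set \<Rightarrow> real" and n :: real
  assumes q: "integrable (count_space shapes) q" "\<And>F. F \<in> shapes \<Longrightarrow> 0 \<le> q F"
    and Q: "(\<integral>F. q F \<partial>count_space shapes) > 0"
    and \<nu>: "prob_space \<nu>" "sets \<nu> = Pow homotopy_types" and n: "n > 0"
  shows "tv_dist (empirical_measure \<nu> Z L) (type_law q) \<le>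
    2 * (\<integral>F. \<bar>real (card {S \<in> clusters Z L. shape_of (cells S) = F}) / n - q F\<bar> \<partial>count_space shapes)
      / (\<integral>F. q F \<partial>count_space shapes)" (is "_ \<le> 2 * ?D / ?Q")
proof -
  have "sets (empirical_measure \<nu> Z L) = Pow homotopy_types \<and>
    (\<forall>A \<in> Pow homotopy_types. \<bar>measure (empirical_measure \<nu> Z L) A - measure (type_law q) A\<bar> \<le> 2 * ?D / ?Q)"
  proof (cases "clusters Z L = {}")
    case True
    have "?D = ?Q" using True q(2) by (intro Bochner_Integration.integral_cong) auto
    moreover have "\<bar>measure \<nu> A - measure (type_law q) A\<bar> \<le> 2" for A
      using prob_space.prob_le_1[OF \<nu>(1), of A] prob_space.prob_le_1[OF prob_space_type_law[OF q Q], of A]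
        measure_nonneg[of \<nu> A] measure_nonneg[of "type_law q" A] by linarith
    ultimately show ?thesis using True Q \<nu>(2) by (simp add: empirical_measure_default)
  next
    case False
    have "\<bar>measure (empirical_measure \<nu> Z L) A - measure (type_law q) A\<bar> \<le> 2 * ?D / ?Q"
      if "A \<subseteq> homotopy_types" for A
      using frequency_deviation_le[OF finite_clusters False _ n q(1) Q, of "\<lambda>S. shape_of (cells S)" "shape_type -` A"]
        empirical_measure_props(2)[OF False that] measure_type_law[OF q Q that] cluster_shape(1)[of _ Z L]
      by (simp add: image_subset_iff)
    then show ?thesis using empirical_measure_props(1)[OF False] by simp
  qed
  then show ?thesis unfolding tv_dist_def by (intro cSUP_least) auto
qed

section \<open>A second moment estimate\<close>

text \<open>
  In the variance of a sum of indicators only the pairs that are not independent contribute, each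
  at most 1. Nonnegativity of the variance of the absolute deviation then bounds its mean by the root
  of the second moment.
\<close>

lemma (in prob_space) abs_count_deviation_le:
  fixes A :: "'i \<Rightarrow> 'a set"
  assumes I: "finite I" and A: "\<And>x. x \<in> I \<Longrightarrow> A x \<in> events" "\<And>x. x \<in> I \<Longrightarrow> prob (A x) = q"
    and dep: "\<And>x. x \<in> I \<Longrightarrow> card {y \<in> I. prob (A x \<inter> A y) \<noteq> q * q} \<le> m"
  shows "expectation (\<lambda>\<omega>. \<bar>(\<Sum>x\<in>I. indicator (A x) \<omega>) - real (card I) * q\<bar>) \<le> sqrt (real (card I * m))"
proof -
  define X where "X = (\<lambda>\<omega>. (\<Sum>x\<in>I. indicator (A x) \<omega>) - real (card I) * q)"
  define P where "P = (\<lambda>x y \<omega>. indicator (A x \<inter> A y) \<omega> - q * indicator (A x) \<omega> - q * indicator (A y) \<omega> + q * q :: real)"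
  have int: "integrable M (indicator B :: 'a \<Rightarrow> real)" if "B \<in> events" for B
    using that by (intro integrable_real_indicator) (auto simp: emeasure_eq_measure)
  have intX: "integrable M X" unfolding X_def
    using A by (intro Bochner_Integration.integrable_diff Bochner_Integration.integrable_sum int) auto
  \<comment> \<open>\<open>P x y\<close> is the product of the centred indicators of \<open>A x\<close> and \<open>A y\<close>.\<close>
  have X2: "(X \<omega>)\<^sup>2 = (\<Sum>x\<in>I. \<Sum>y\<in>I. P x y \<omega>)" for \<omega>
  proof -
    have "X \<omega> = (\<Sum>x\<in>I. indicator (A x) \<omega> - q)" by (simp add: X_def sum_subtractf)
    then have "(X \<omega>)\<^sup>2 = (\<Sum>x\<in>I. \<Sum>y\<in>I. (indicator (A x) \<omega> - q) * (indicator (A y) \<omega> - q))"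
      by (simp add: power2_eq_square sum_product)
    then show ?thesis by (simp add: P_def indicator_inter_arith algebra_simps)
  qed
  have intP: "integrable M (P x y)" if "x \<in> I" "y \<in> I" for x y
    unfolding P_def using A that
    by (intro Bochner_Integration.integrable_diff Bochner_Integration.integrable_add integrable_mult_right int) auto
  have EP: "expectation (P x y) = prob (A x \<inter> A y) - q * q" if "x \<in> I" "y \<in> I" for x y
    unfolding P_def using A[OF that(1)] A[OF that(2)]
    by (simp add: int prob_space)
  have EP_le: "expectation (P x y) \<le> (if prob (A x \<inter> A y) \<noteq> q * q then 1 else 0)" if "x \<in> I" "y \<in> I" for x y
  proof -
    have "prob (A x \<inter> A y) \<le> 1" "0 \<le> q * q" by (simp_all add: prob_le_1)
    then have "prob (A x \<inter> A y) - q * q \<le> 1" by linarith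
    then show ?thesis by (simp add: EP[OF that])
  qed
  have intX2: "integrable M (\<lambda>\<omega>. (X \<omega>)\<^sup>2)"
    unfolding X2 by (intro Bochner_Integration.integrable_sum intP)
  have "expectation (\<lambda>\<omega>. (X \<omega>)\<^sup>2) = (\<Sum>x\<in>I. \<Sum>y\<in>I. expectation (P x y))"
    unfolding X2 by (simp add: Bochner_Integration.integral_sum intP Bochner_Integration.integrable_sum)
  also have "\<dots> \<le> (\<Sum>x\<in>I. \<Sum>y\<in>I. if prob (A x \<inter> A y) \<noteq> q * q then 1 else 0)"
    by (intro sum_mono EP_le)
  also have "\<dots> = (\<Sum>x\<in>I. real (card {y \<in> I. prob (A x \<inter> A y) \<noteq> q * q}))"
    using I by (intro sum.cong refl) (subst sum.inter_filter[symmetric], auto)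
  also have "\<dots> \<le> (\<Sum>x\<in>I. real m)"
    by (intro sum_mono) (use dep in auto)
  also have "\<dots> = real (card I * m)" by simp
  finally have E2: "expectation (\<lambda>\<omega>. (X \<omega>)\<^sup>2) \<le> real (card I * m)" .
  have "0 \<le> expectation (\<lambda>\<omega>. \<bar>X \<omega>\<bar>\<^sup>2) - (expectation (\<lambda>\<omega>. \<bar>X \<omega>\<bar>))\<^sup>2"
    using variance_positive[of "\<lambda>\<omega>. \<bar>X \<omega>\<bar>"] variance_eq[of "\<lambda>\<omega>. \<bar>X \<omega>\<bar>"] intX intX2 by simp
  then have "(expectation (\<lambda>\<omega>. \<bar>X \<omega>\<bar>))\<^sup>2 \<le> real (card I * m)" using E2 by simp
  then show ?thesis unfolding X_def by (rule real_le_rsqrt)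
qed

section \<open>Independent colourings\<close>

locale site_percolation = prob_space M
  for M :: "'w measure" +
  fixes Z :: "'w \<Rightarrow> (int ^ 'd::finite) set" and p :: real
  assumes p: "0 < p" "p < 1" and coloring: "random_coloring M Z p"
begin

text \<open>
  The probability that the black sites within \<open>B\<close> are those of \<open>G\<close>. The probability of a local event is a
  finite sum of such weights, so translation invariance and independence reduce to identities for products.
\<close>

definition weight :: "(int ^ 'd) set \<Rightarrow> (int ^ 'd) set \<Rightarrow> real" where
  "weight B G = (\<Prod>x\<in>B. if x \<in> G then p else 1 - p)"

lemma weight_pos: "weight B G > 0"
  unfolding weight_def using p by (intro prod_pos) auto

lemma weight_translation: "weight ((+) x ` B) ((+) x ` G) = weight B G"
  unfolding weight_def by (subst prod.reindex) (auto intro!: prod.cong)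

lemma weight_Un:
  assumes "finite B" "finite C" "B \<inter> C = {}" "G \<subseteq> B" "H \<subseteq> C"
  shows "weight (B \<union> C) (G \<union> H) = weight B G * weight C H"
proof -
  have "weight (B \<union> C) (G \<union> H) = weight B (G \<union> H) * weight C (G \<union> H)"
    unfolding weight_def by (rule prod.union_disjoint) (use assms in auto)
  also have "weight B (G \<union> H) = weight B G" unfolding weight_def
    using assms by (intro prod.cong) auto
  also have "weight C (G \<union> H) = weight C H" unfolding weight_def
    using assms by (intro prod.cong) auto
  finally show ?thesis .
qed

lemma site_event [measurable]: "{\<omega> \<in> space M. x \<in> Z \<omega>} \<in> events"
proof -
  have "(\<lambda>\<omega>. x \<in> Z \<omega>) \<in> measurable M (count_space UNIV)"
    using coloring by (auto simp: random_coloring_def indep_vars_def)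
  then have "(\<lambda>\<omega>. x \<in> Z \<omega>) -` {True} \<inter> space M \<in> events" by (rule measurable_sets) simp
  also have "(\<lambda>\<omega>. x \<in> Z \<omega>) -` {True} \<inter> space M = {\<omega> \<in> space M. x \<in> Z \<omega>}" by auto
  finally show ?thesis .
qed

lemma pattern:
  assumes "finite B" "G \<subseteq> B"
  shows "{\<omega> \<in> space M. Z \<omega> \<inter> B = G} \<in> events" "prob {\<omega> \<in> space M. Z \<omega> \<inter> B = G} = weight B G"
proof -
  have eq: "{\<omega> \<in> space M. Z \<omega> \<inter> B = G} = {\<omega> \<in> space M. \<forall>x\<in>B. x \<in> Z \<omega> \<longleftrightarrow> x \<in> G}"
    using assms by blast
  show "{\<omega> \<in> space M. Z \<omega> \<inter> B = G} \<in> events"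
    unfolding eq using assms(1) by measurable
  show "prob {\<omega> \<in> space M. Z \<omega> \<inter> B = G} = weight B G"
  proof (cases "B = {}")
    case True
    then show ?thesis using assms by (simp add: weight_def prob_space)
  next
    case False
    have ind: "indep_vars (\<lambda>_. count_space UNIV) (\<lambda>x \<omega>. x \<in> Z \<omega>) UNIV"
      using coloring by (simp add: random_coloring_def)
    have pr: "prob {\<omega> \<in> space M. x \<in> Z \<omega>} = p" for x
      using coloring by (simp add: random_coloring_def)
    have "{\<omega> \<in> space M. Z \<omega> \<inter> B = G} = (\<Inter>x\<in>B. (\<lambda>\<omega>. x \<in> Z \<omega>) -` {x \<in> G} \<inter> space M)"
      unfolding eq using False by auto
    also have "prob \<dots> = (\<Prod>x\<in>B. prob ((\<lambda>\<omega>. x \<in> Z \<omega>) -` {x \<in> G} \<inter> space M))"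
      by (rule indep_varsD[OF ind False assms(1)]) auto
    also have "\<dots> = weight B G"
      unfolding weight_def
    proof (intro prod.cong refl)
      fix x
      show "prob ((\<lambda>\<omega>. x \<in> Z \<omega>) -` {x \<in> G} \<inter> space M) = (if x \<in> G then p else 1 - p)"
      proof (cases "x \<in> G")
        case True
        then have "(\<lambda>\<omega>. x \<in> Z \<omega>) -` {x \<in> G} \<inter> space M = {\<omega> \<in> space M. x \<in> Z \<omega>}" by auto
        then show ?thesis using True pr by simp
      next
        case False
        then have "(\<lambda>\<omega>. x \<in> Z \<omega>) -` {x \<in> G} \<inter> space M = space M - {\<omega> \<in> space M. x \<in> Z \<omega>}" by auto
        then show ?thesis using False pr prob_compl[OF site_event] by simp
      qed
    qed
    finally show ?thesis .
  qed
qed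

lemma local_event:
  assumes "finite B" "\<G> \<subseteq> Pow B"
  shows "{\<omega> \<in> space M. Z \<omega> \<inter> B \<in> \<G>} \<in> events"
    "prob {\<omega> \<in> space M. Z \<omega> \<inter> B \<in> \<G>} = (\<Sum>G\<in>\<G>. weight B G)"
proof -
  have fin: "finite \<G>" using assms finite_subset by blast
  have eq: "{\<omega> \<in> space M. Z \<omega> \<inter> B \<in> \<G>} = (\<Union>G\<in>\<G>. {\<omega> \<in> space M. Z \<omega> \<inter> B = G})" by auto
  have pat: "G \<subseteq> B" if "G \<in> \<G>" for G using assms that by auto
  show "{\<omega> \<in> space M. Z \<omega> \<inter> B \<in> \<G>} \<in> events"
    unfolding eq using fin pattern(1)[OF assms(1) pat] by (intro sets.finite_UN) auto
  have "prob (\<Union>G\<in>\<G>. {\<omega> \<in> space M. Z \<omega> \<inter> B = G}) = (\<Sum>G\<in>\<G>. prob {\<omega> \<in> space M. Z \<omega> \<inter> B = G})"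
    using fin pattern(1)[OF assms(1) pat]
    by (intro finite_measure_finite_Union) (auto simp: disjoint_family_on_def)
  then show "prob {\<omega> \<in> space M. Z \<omega> \<inter> B \<in> \<G>} = (\<Sum>G\<in>\<G>. weight B G)"
    unfolding eq using pattern(2)[OF assms(1) pat] by simp
qed

text \<open>
  Each pattern on the union splits uniquely into a pattern on \<open>B\<close> and one on \<open>C\<close>, and its weight is
  the product of the two weights.
\<close>

lemma local_events_indep:
  assumes "finite B" "finite C" "B \<inter> C = {}" "\<G> \<subseteq> Pow B" "\<H> \<subseteq> Pow C"
  shows "prob ({\<omega> \<in> space M. Z \<omega> \<inter> B \<in> \<G>} \<inter> {\<omega> \<in> space M. Z \<omega> \<inter> C \<in> \<H>}) =
    prob {\<omega> \<in> space M. Z \<omega> \<inter> B \<in> \<G>} * prob {\<omega> \<in> space M. Z \<omega> \<inter> C \<in> \<H>}"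
proof -
  let ?K = "(\<lambda>(G, H). G \<union> H) ` (\<G> \<times> \<H>)"
  have inj: "inj_on (\<lambda>(G, H). G \<union> H) (\<G> \<times> \<H>)"
  proof (rule inj_onI, clarify)
    fix G H G' H' assume "G \<in> \<G>" "H \<in> \<H>" "G' \<in> \<G>" "H' \<in> \<H>" "G \<union> H = G' \<union> H'"
    moreover from this have "G \<subseteq> B" "G' \<subseteq> B" "H \<subseteq> C" "H' \<subseteq> C" using assms by auto
    ultimately show "G = G' \<and> H = H'" using assms(3) by blast
  qed
  have mem: "Z \<omega> \<inter> (B \<union> C) \<in> ?K \<longleftrightarrow> Z \<omega> \<inter> B \<in> \<G> \<and> Z \<omega> \<inter> C \<in> \<H>" for \<omega>
  proof
    assume "Z \<omega> \<inter> (B \<union> C) \<in> ?K"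
    then obtain G H where GH: "G \<in> \<G>" "H \<in> \<H>" "Z \<omega> \<inter> (B \<union> C) = G \<union> H" by auto
    then have "G \<subseteq> B" "H \<subseteq> C" using assms by auto
    then have "Z \<omega> \<inter> B = G" "Z \<omega> \<inter> C = H" using GH(3) assms(3) by blast+
    then show "Z \<omega> \<inter> B \<in> \<G> \<and> Z \<omega> \<inter> C \<in> \<H>" using GH by simp
  next
    assume "Z \<omega> \<inter> B \<in> \<G> \<and> Z \<omega> \<inter> C \<in> \<H>"
    then show "Z \<omega> \<inter> (B \<union> C) \<in> ?K"
      by (intro image_eqI[of _ _ "(Z \<omega> \<inter> B, Z \<omega> \<inter> C)"]) auto
  qed
  have "{\<omega> \<in> space M. Z \<omega> \<inter> B \<in> \<G>} \<inter> {\<omega> \<in> space M. Z \<omega> \<inter> C \<in> \<H>} = {\<omega> \<in> space M. Z \<omega> \<inter> (B \<union> C) \<in> ?K}"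
    unfolding mem by auto
  also have "prob \<dots> = (\<Sum>K\<in>?K. weight (B \<union> C) K)"
    by (rule local_event(2)) (use assms in auto)
  also have "\<dots> = (\<Sum>(G, H)\<in>\<G> \<times> \<H>. weight (B \<union> C) (G \<union> H))"
    by (subst sum.reindex[OF inj]) (simp add: case_prod_unfold)
  also have "\<dots> = (\<Sum>(G, H)\<in>\<G> \<times> \<H>. weight B G * weight C H)"
    using assms by (intro sum.cong) (auto intro!: weight_Un)
  also have "\<dots> = (\<Sum>G\<in>\<G>. weight B G) * (\<Sum>H\<in>\<H>. weight C H)"
    by (simp add: sum_product sum.cartesian_product)
  finally show ?thesis using assms by (simp add: local_event(2))
qed

section \<open>The density of a shape\<close>

definition cluster_event :: "(int ^ 'd) set \<Rightarrow> int ^ 'd \<Rightarrow> 'w set" where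
  "cluster_event F x = {\<omega> \<in> space M. cube_interior ((+) x ` F) \<in> components (cube_interior (Z \<omega>))}"

definition shape_density :: "(int ^ 'd) set \<Rightarrow> real" where
  "shape_density F = prob (cluster_event F 0)"

text \<open>
  By locality these are the colourings of the neighbourhood of \<open>F\<close> that make \<open>cube_interior F\<close> a component,
  whatever the colours elsewhere.
\<close>

definition isolating_patterns :: "(int ^ 'd) set \<Rightarrow> (int ^ 'd) set set" where
  "isolating_patterns F = {G. G \<subseteq> neighbourhood F \<and> cube_interior F \<in> components (cube_interior G)}"

lemma cluster_event_local:
  assumes "finite F"
  shows "cluster_event F x = {\<omega> \<in> space M. Z \<omega> \<inter> (+) x ` neighbourhood F \<in> (`) ((+) x) ` isolating_patterns F}"
proof -
  have "cube_interior ((+) x ` F) \<in> components (cube_interior (Z \<omega>)) \<longleftrightarrow>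
    Z \<omega> \<inter> (+) x ` neighbourhood F \<in> (`) ((+) x) ` isolating_patterns F" for \<omega>
  proof -
    define W where "W = (+) (-x) ` (Z \<omega> \<inter> (+) x ` neighbourhood F)"
    have W: "(+) x ` W = Z \<omega> \<inter> (+) x ` neighbourhood F" by (simp add: W_def image_image)
    have WN: "W \<subseteq> neighbourhood F" by (auto simp: W_def)
    have "cube_interior ((+) x ` F) \<in> components (cube_interior (Z \<omega>)) \<longleftrightarrow>
        cube_interior ((+) x ` F) \<in> components (cube_interior ((+) x ` W))"
      by (rule component_local_iff) (use assms in \<open>auto simp: W neighbourhood_translation\<close>)
    also have "\<dots> \<longleftrightarrow> W \<in> isolating_patterns F"
      using WN by (simp add: component_translation_iff isolating_patterns_def)
    also have "\<dots> \<longleftrightarrow> (+) x ` W \<in> (`) ((+) x) ` isolating_patterns F"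
      by (subst inj_image_mem_iff) (auto simp: inj_image_eq_iff intro!: inj_onI)
    finally show ?thesis unfolding W .
  qed
  then show ?thesis by (simp add: cluster_event_def)
qed

lemma isolating_patterns_image_subset:
  "(`) ((+) x) ` isolating_patterns F \<subseteq> Pow ((+) x ` neighbourhood F)"
  by (auto simp: isolating_patterns_def)

lemma cluster_event_prob:
  assumes "finite F"
  shows "cluster_event F x \<in> events" "prob (cluster_event F x) = shape_density F"
    "shape_density F = (\<Sum>G\<in>isolating_patterns F. weight (neighbourhood F) G)"
proof -
  have *: "cluster_event F x \<in> events \<and>
    prob (cluster_event F x) = (\<Sum>G\<in>isolating_patterns F. weight (neighbourhood F) G)" for x
  proof -
    have fin: "finite ((+) x ` neighbourhood F)" by (intro finite_imageI finite_neighbourhood assms)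
    note ev = local_event[OF fin isolating_patterns_image_subset]
    have "prob (cluster_event F x) = (\<Sum>G\<in>(`) ((+) x) ` isolating_patterns F. weight ((+) x ` neighbourhood F) G)"
      unfolding cluster_event_local[OF assms] by (rule ev(2))
    also have "\<dots> = (\<Sum>G\<in>isolating_patterns F. weight (neighbourhood F) G)"
      by (subst sum.reindex) (auto intro!: inj_onI simp: inj_image_eq_iff weight_translation)
    finally show ?thesis using ev(1) unfolding cluster_event_local[OF assms] by simp
  qed
  show "cluster_event F x \<in> events" "prob (cluster_event F x) = shape_density F"
    "shape_density F = (\<Sum>G\<in>isolating_patterns F. weight (neighbourhood F) G)"
    unfolding shape_density_def using * by auto
qed

lemma shape_finite: "F \<in> shapes \<Longrightarrow> finite F" and shape_zero: "F \<in> shapes \<Longrightarrow> 0 \<in> F"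
  by (auto simp: shapes_def)

text \<open>
  Colouring \<open>F\<close> black and its surrounding cells white is one admissible pattern.
\<close>

lemma shape_density_pos:
  assumes "F \<in> shapes" shows "shape_density F > 0"
proof -
  have F: "finite F" "F \<noteq> {}" "connected (cube_interior F)" using assms by (auto simp: shapes_def)
  have "components (cube_interior F) = {cube_interior F}"
    using F by (simp add: components_eq_sing_iff cube_interior_nonempty_iff)
  then have "F \<in> isolating_patterns F"
    using subset_neighbourhood by (simp add: isolating_patterns_def)
  moreover have "finite (isolating_patterns F)"
    by (rule finite_subset[of _ "Pow (neighbourhood F)"])
       (auto simp: isolating_patterns_def finite_neighbourhood F)
  ultimately show ?thesis
    unfolding cluster_event_prob(3)[OF F(1)] using weight_pos
    by (intro sum_pos) auto
qed

text \<open>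
  All shapes contain the origin, and the cell of the origin lies in at most one cluster. It follows that
  the densities have a finite sum, so that large shapes contribute little.
\<close>

lemma cluster_events_disjoint: "disjoint_family_on (\<lambda>F. cluster_event F 0) shapes"
  unfolding disjoint_family_on_def
proof (intro ballI impI)
  fix F G :: "(int ^ 'd) set" assume FG: "F \<in> shapes" "G \<in> shapes" "F \<noteq> G"
  show "cluster_event F 0 \<inter> cluster_event G 0 = {}"
  proof (rule ccontr)
    assume "cluster_event F 0 \<inter> cluster_event G 0 \<noteq> {}"
    then obtain \<omega> where "cube_interior F \<in> components (cube_interior (Z \<omega>))"
      "cube_interior G \<in> components (cube_interior (Z \<omega>))" by (auto simp: cluster_event_def)
    moreover have "cube_center 0 \<in> cube_interior F \<inter> cube_interior G"
      using FG by (simp add: cube_center_mem_iff shape_zero)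
    ultimately have "cube_interior F = cube_interior G" using components_eq by blast
    then show False using FG(3) by (metis cells_cube_interior)
  qed
qed

lemma shape_density_integrable: "integrable (count_space shapes) shape_density"
proof -
  have "(\<integral>\<^sup>+F. ennreal (norm (shape_density F)) \<partial>count_space shapes) =
    (\<integral>\<^sup>+F. emeasure M (cluster_event F 0) \<partial>count_space shapes)"
    by (intro nn_integral_cong) (simp add: shape_density_def emeasure_eq_measure)
  also have "\<dots> = emeasure M (\<Union>F\<in>shapes. cluster_event F 0)"
    by (rule emeasure_UN_countable[symmetric])
       (auto intro: cluster_event_prob shape_finite countable_shapes cluster_events_disjoint)
  also have "\<dots> < \<infinity>" by (simp add: less_top[symmetric])
  finally show ?thesis by (simp add: integrable_iff_bounded)
qed

lemma cluster_events_indep: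
  assumes "finite F" "(+) x ` neighbourhood F \<inter> (+) y ` neighbourhood F = {}"
  shows "prob (cluster_event F x \<inter> cluster_event F y) = shape_density F * shape_density F"
proof -
  have fin: "finite ((+) x ` neighbourhood F)" for x by (intro finite_imageI finite_neighbourhood assms)
  have "prob (cluster_event F x \<inter> cluster_event F y) = prob (cluster_event F x) * prob (cluster_event F y)"
    unfolding cluster_event_local[OF assms(1)]
    by (rule local_events_indep[OF fin fin assms(2)]) (rule isolating_patterns_image_subset)+
  then show ?thesis using cluster_event_prob(2)[OF assms(1)] by simp
qed

lemma shape_count:
  assumes "F \<in> shapes" "\<omega> \<in> space M"
  shows "real (card {S \<in> clusters (Z \<omega>) L. shape_of (cells S) = F}) =
    (\<Sum>x\<in>anchors F L. indicator (cluster_event F x) \<omega>)"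
proof -
  have "card {S \<in> clusters (Z \<omega>) L. shape_of (cells S) = F} =
    card {x \<in> anchors F L. cube_interior ((+) x ` F) \<in> components (cube_interior (Z \<omega>))}"
    by (rule bij_betw_same_card[OF clusters_of_shape[OF assms(1)], symmetric])
  also have "real \<dots> = (\<Sum>x\<in>anchors F L. if \<omega> \<in> cluster_event F x then 1 else 0)"
    using assms finite_anchors[OF shape_zero[OF assms(1)]]
    by (subst sum.inter_filter[symmetric]) (auto simp: cluster_event_def)
  finally show ?thesis by (simp add: indicator_def of_bool_def)
qed

text \<open>
  The window consists of \<open>L\<^sup>d\<close> unit cubes, so this compares the number of clusters of shape \<open>F\<close> per unit volume
  with its limit.
\<close>

definition deviation :: "nat \<Rightarrow> (int ^ 'd) set \<Rightarrow> 'w \<Rightarrow> real" where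
  "deviation L F \<omega> = \<bar>(\<Sum>x\<in>anchors F L. indicator (cluster_event F x) \<omega>) / real (L ^ CARD('d)) - shape_density F\<bar>"

lemma indicator_cluster_event_integrable:
  "F \<in> shapes \<Longrightarrow> integrable M (indicator (cluster_event F x) :: 'w \<Rightarrow> real)"
  by (intro integrable_real_indicator cluster_event_prob(1) shape_finite) (auto simp: emeasure_eq_measure)

lemma deviation_integrable: "F \<in> shapes \<Longrightarrow> integrable M (deviation L F)"
  unfolding deviation_def
  by (intro integrable_abs Bochner_Integration.integrable_diff integrable_divide_zero
      Bochner_Integration.integrable_sum indicator_cluster_event_integrable integrable_const) auto

lemma card_anchors_le:
  fixes F :: "(int ^ 'd) set"
  assumes "F \<in> shapes" shows "card (anchors F L) \<le> L ^ CARD('d)"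
  using card_mono[OF finite_sites anchors_subset_sites[OF shape_zero[OF assms]]] card_sites[where 'd='d]
  by metis

text \<open>
  The bound is independent of \<open>L\<close> and summable over the shapes: it serves as majorant for dominated
  convergence.
\<close>

lemma deviation_le:
  assumes "F \<in> shapes" "L > 0"
  shows "expectation (deviation L F) \<le> 2 * shape_density F"
proof -
  let ?n = "real (L ^ CARD('d))" and ?S = "\<lambda>\<omega>. \<Sum>x\<in>anchors F L. indicator (cluster_event F x) \<omega> :: real"
  have n: "?n > 0" using assms by simp
  have q: "shape_density F \<ge> 0" by (simp add: shape_density_def)
  have intS: "integrable M ?S"
    by (intro Bochner_Integration.integrable_sum indicator_cluster_event_integrable assms)
  have "expectation (deviation L F) \<le> expectation (\<lambda>\<omega>. ?S \<omega> / ?n + shape_density F)"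
  proof (rule integral_mono[OF deviation_integrable[OF assms(1)]])
    show "integrable M (\<lambda>\<omega>. ?S \<omega> / ?n + shape_density F)"
      using intS by (intro Bochner_Integration.integrable_add integrable_divide_zero) auto
    fix \<omega>
    have "?S \<omega> / ?n \<ge> 0" by (intro divide_nonneg_nonneg sum_nonneg) auto
    then show "deviation L F \<omega> \<le> ?S \<omega> / ?n + shape_density F"
      unfolding deviation_def using q by linarith
  qed
  also have "\<dots> = real (card (anchors F L)) * shape_density F / ?n + shape_density F"
    using intS assms(1) by (simp add: prob_space Bochner_Integration.integral_sum
        indicator_cluster_event_integrable cluster_event_prob shape_finite)
  also have "\<dots> \<le> ?n * shape_density F / ?n + shape_density F"
    using card_anchors_le[OF assms(1), of L] q
    by (intro add_right_mono divide_right_mono mult_right_mono of_nat_mono) auto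
  finally show ?thesis using n by simp
qed

text \<open>
  The weak law for a single shape. Copies at \<open>x\<close> and \<open>y\<close> are independent unless \<open>y - x\<close> is a difference of
  two cells of the neighbourhood of \<open>F\<close>, so the second moment estimate gives an error of order \<open>L\<close> to the power
  \<open>-d/2\<close>; the anchors fill the window up to a boundary layer.
\<close>

lemma deviation_tendsto_0:
  assumes F: "F \<in> shapes"
  shows "(\<lambda>L. expectation (deviation L F)) \<longlonglongrightarrow> 0"
proof -
  \<comment> \<open>Anchors \<open>y\<close> whose copy may depend on the copy at \<open>x\<close> lie in \<open>x + V\<close>.\<close>
  define V where "V = (\<lambda>(a, b). a - b) ` (neighbourhood F \<times> neighbourhood F)"
  have finV: "finite V" unfolding V_def using finite_neighbourhood[OF shape_finite[OF F]] by simp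
  let ?n = "\<lambda>L. real (L ^ CARD('d))" and ?q = "shape_density F"
    and ?S = "\<lambda>L \<omega>. \<Sum>x\<in>anchors F L. indicator (cluster_event F x) \<omega> :: real"
    and ?c = "\<lambda>L. real (card (anchors F L))"
  have q: "?q \<ge> 0" by (simp add: shape_density_def)
  have dep: "card {y \<in> anchors F L. prob (cluster_event F x \<inter> cluster_event F y) \<noteq> ?q * ?q} \<le> card V" for x L
  proof -
    have "{y \<in> anchors F L. prob (cluster_event F x \<inter> cluster_event F y) \<noteq> ?q * ?q} \<subseteq> (+) x ` V"
    proof
      fix y assume "y \<in> {y \<in> anchors F L. prob (cluster_event F x \<inter> cluster_event F y) \<noteq> ?q * ?q}"
      then have "(+) x ` neighbourhood F \<inter> (+) y ` neighbourhood F \<noteq> {}"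
        using cluster_events_indep[OF shape_finite[OF F]] by blast
      then obtain a b where "a \<in> neighbourhood F" "b \<in> neighbourhood F" "x + a = y + b" by auto
      then have "a - b \<in> V" "y = x + (a - b)" by (force simp: V_def, simp add: algebra_simps)
      then show "y \<in> (+) x ` V" by blast
    qed
    then have "card {y \<in> anchors F L. prob (cluster_event F x \<inter> cluster_event F y) \<noteq> ?q * ?q} \<le> card ((+) x ` V)"
      by (intro card_mono finite_imageI finV)
    also have "\<dots> \<le> card V" by (rule card_image_le[OF finV])
    finally show ?thesis .
  qed
  have triangle: "\<bar>a\<bar> \<le> t + v" if "a = u - v" "\<bar>u\<bar> = t" "v \<ge> 0" for a t u v :: real
    using that by linarith
  have bound: "expectation (deviation L F) \<le> sqrt (real (card V)) / sqrt (?n L) + ?q * (1 - ?c L / ?n L)"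
    if "L > 0" for L
  proof -
    have n: "?n L > 0" using that by simp
    have intS: "integrable M (\<lambda>\<omega>. \<bar>?S L \<omega> - ?c L * ?q\<bar>)"
      by (intro integrable_abs Bochner_Integration.integrable_diff Bochner_Integration.integrable_sum
          indicator_cluster_event_integrable F integrable_const)
    have cn: "?c L \<le> ?n L" using card_anchors_le[OF F, of L] by (simp only: of_nat_le_iff)
    have "expectation (deviation L F) \<le> expectation (\<lambda>\<omega>. \<bar>?S L \<omega> - ?c L * ?q\<bar> / ?n L + ?q * (1 - ?c L / ?n L))"
    proof (rule integral_mono[OF deviation_integrable[OF F]])
      show "integrable M (\<lambda>\<omega>. \<bar>?S L \<omega> - ?c L * ?q\<bar> / ?n L + ?q * (1 - ?c L / ?n L))"
        using intS by (intro Bochner_Integration.integrable_add integrable_divide_zero integrable_const) auto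
      fix \<omega>
      have "?S L \<omega> / ?n L - ?q = (?S L \<omega> - ?c L * ?q) / ?n L - ?q * (1 - ?c L / ?n L)"
        using n by (simp add: field_simps)
      moreover have "\<bar>(?S L \<omega> - ?c L * ?q) / ?n L\<bar> = \<bar>?S L \<omega> - ?c L * ?q\<bar> / ?n L"
        using n by (simp add: abs_divide)
      moreover have "?q * (1 - ?c L / ?n L) \<ge> 0"
        using q n cn by (intro mult_nonneg_nonneg) (simp_all add: divide_le_eq_1)
      ultimately show "deviation L F \<omega> \<le> \<bar>?S L \<omega> - ?c L * ?q\<bar> / ?n L + ?q * (1 - ?c L / ?n L)"
        unfolding deviation_def by (rule triangle)
    qed
    also have "\<dots> = expectation (\<lambda>\<omega>. \<bar>?S L \<omega> - ?c L * ?q\<bar>) / ?n L + ?q * (1 - ?c L / ?n L)"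
      using intS by (simp add: prob_space)
    also have "expectation (\<lambda>\<omega>. \<bar>?S L \<omega> - ?c L * ?q\<bar>) \<le> sqrt (real (card (anchors F L) * card V))"
      by (rule abs_count_deviation_le)
         (use dep cluster_event_prob[OF shape_finite[OF F]] finite_anchors[OF shape_zero[OF F]] in auto)
    also have "\<dots> \<le> sqrt (?n L * real (card V))"
      using cn by (intro real_sqrt_le_mono) (simp add: mult_right_mono)
    also have "sqrt (?n L * real (card V)) / ?n L = sqrt (real (card V)) / sqrt (?n L)"
      using n by (simp add: real_sqrt_mult real_div_sqrt field_simps)
    finally show ?thesis using n by (simp add: divide_right_mono)
  qed
  have "filterlim (\<lambda>L. sqrt (?n L)) at_top sequentially"
  proof -
    have "filterlim (\<lambda>L. real L ^ CARD('d)) at_top sequentially"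
      by (intro filterlim_pow_at_top filterlim_real_sequentially) simp
    then show ?thesis by (intro filterlim_compose[OF sqrt_at_top]) simp
  qed
  then have "(\<lambda>L. sqrt (real (card V)) / sqrt (?n L)) \<longlonglongrightarrow> 0"
    by (intro tendsto_divide_0[OF tendsto_const] filterlim_at_top_imp_at_infinity)
  moreover have "(\<lambda>L. ?q * (1 - ?c L / ?n L)) \<longlonglongrightarrow> ?q * (1 - 1)"
    using card_anchors_asymp[OF shape_finite[OF F] shape_zero[OF F]] by (intro tendsto_intros)
  ultimately have lim: "(\<lambda>L. sqrt (real (card V)) / sqrt (?n L) + ?q * (1 - ?c L / ?n L)) \<longlonglongrightarrow> 0"
    using tendsto_add by fastforce
  show ?thesis
  proof (rule tendsto_sandwich[OF _ _ tendsto_const lim])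
    show "\<forall>\<^sub>F L in sequentially. 0 \<le> expectation (deviation L F)"
      by (intro always_eventually allI integral_nonneg_AE) (auto simp: deviation_def)
    show "\<forall>\<^sub>F L in sequentially. expectation (deviation L F) \<le> sqrt (real (card V)) / sqrt (?n L) + ?q * (1 - ?c L / ?n L)"
      using eventually_gt_at_top[of 0] by eventually_elim (rule bound)
  qed
qed

section \<open>Convergence of the empirical measures\<close>

lemma shape_density_nonneg: "shape_density F \<ge> 0"
  by (simp add: shape_density_def)

lemma total_density_pos: "(\<integral>F. shape_density F \<partial>count_space shapes) > 0"
proof -
  have "cube_interior {0 :: int ^ 'd} = interior (lattice_cube 1 0)" by (simp add: cube_interior_def)
  then have "shape_of {0 :: int ^ 'd} \<in> shapes"
    by (intro shape_of_mem_shapes) (auto simp: connected_interior_cube)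
  then have "\<not> (AE F in count_space shapes. shape_density F = 0)"
    using shape_density_pos by (force simp: AE_count_space)
  then have "(\<integral>F. shape_density F \<partial>count_space shapes) \<noteq> 0"
    using integral_nonneg_eq_0_iff_AE[OF shape_density_integrable] shape_density_nonneg by auto
  moreover have "(\<integral>F. shape_density F \<partial>count_space shapes) \<ge> 0"
    by (intro integral_nonneg_AE) (simp add: shape_density_nonneg)
  ultimately show ?thesis by linarith
qed

lemma mean_deviation_integrable:
  assumes "L > 0"
  shows "integrable (count_space shapes) (\<lambda>F. expectation (deviation L F))"
proof (rule Bochner_Integration.integrable_bound)
  show "integrable (count_space shapes) (\<lambda>F. 2 * shape_density F)"
    by (intro integrable_mult_right shape_density_integrable)
  have "0 \<le> expectation (deviation L F)" for F
    by (intro integral_nonneg_AE) (simp add: deviation_def)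
  then show "AE F in count_space shapes. norm (expectation (deviation L F)) \<le> norm (2 * shape_density F)"
    using deviation_le[OF _ assms] shape_density_nonneg by (auto simp: AE_count_space)
qed simp

text \<open>
  Dominated convergence over the countable set of shapes turns the weak law for each shape into
  convergence of the whole family of counts in mean \<open>\<ell>\<^sup>1\<close> distance.
\<close>

lemma mean_total_deviation_tendsto_0:
  "(\<lambda>L. \<integral>F. expectation (deviation L F) \<partial>count_space shapes) \<longlonglongrightarrow> 0"
proof -
  have nonneg: "0 \<le> expectation (deviation L F)" for L F
    by (intro integral_nonneg_AE) (simp add: deviation_def)
  \<comment> \<open>The shift avoids \<open>L = 0\<close>, where the majorant can fail because of the convention for division by zero.\<close>
  have "(\<lambda>L. \<integral>F. expectation (deviation (Suc L) F) \<partial>count_space shapes) \<longlonglongrightarrow> (\<integral>F. 0 \<partial>count_space (shapes :: (int ^ 'd) set set))"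
  proof (rule integral_dominated_convergence)
    show "integrable (count_space shapes) (\<lambda>F. 2 * shape_density F)"
      by (intro integrable_mult_right shape_density_integrable)
    show "AE F in count_space shapes. (\<lambda>L. expectation (deviation (Suc L) F)) \<longlonglongrightarrow> 0"
      using LIMSEQ_Suc[OF deviation_tendsto_0] by (simp add: AE_count_space)
    show "AE F in count_space shapes. norm (expectation (deviation (Suc L) F)) \<le> 2 * shape_density F" for L
      using deviation_le[of _ "Suc L"] nonneg by (simp add: AE_count_space)
  qed auto
  then have "(\<lambda>L. \<integral>F. expectation (deviation (Suc L) F) \<partial>count_space shapes) \<longlonglongrightarrow> 0" by simp
  then show ?thesis by (rule LIMSEQ_imp_Suc)
qed

lemma tv_dist_le_total_deviation:
  assumes "prob_space \<nu>" "sets \<nu> = Pow homotopy_types" "L > 0" "\<omega> \<in> space M"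
  shows "tv_dist (empirical_measure \<nu> (Z \<omega>) L) (type_law shape_density) \<le>
    2 * (\<integral>F. deviation L F \<omega> \<partial>count_space shapes) / (\<integral>F. shape_density F \<partial>count_space shapes)"
proof -
  have "(\<integral>F. \<bar>real (card {S \<in> clusters (Z \<omega>) L. shape_of (cells S) = F}) / real (L ^ CARD('d)) - shape_density F\<bar> \<partial>count_space shapes)
    = (\<integral>F. deviation L F \<omega> \<partial>count_space shapes)"
    by (intro Bochner_Integration.integral_cong refl) (simp add: shape_count[OF _ assms(4)] deviation_def)
  moreover have "real (L ^ CARD('d)) > 0" using assms(3) by simp
  ultimately show ?thesis
    using tv_dist_empirical_le[OF shape_density_integrable shape_density_nonneg total_density_pos assms(1,2), of "real (L ^ CARD('d))" "Z \<omega>" L]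
    by simp
qed

lemma deviation_summable:
  assumes "\<omega> \<in> space M"
  shows "integrable (count_space shapes) (\<lambda>F. deviation L F \<omega>)"
proof -
  have "integrable (count_space shapes) (\<lambda>F. real (card {S \<in> clusters (Z \<omega>) L. shape_of (cells S) = F}) * indicator UNIV F)"
    by (rule integral_fibre_cards) (auto intro: cluster_shape)
  then have "integrable (count_space shapes)
    (\<lambda>F. \<bar>real (card {S \<in> clusters (Z \<omega>) L. shape_of (cells S) = F}) / real (L ^ CARD('d)) - shape_density F\<bar>)"
    using shape_density_integrable
    by (intro integrable_abs Bochner_Integration.integrable_diff integrable_divide_zero) auto
  also have "?this \<longleftrightarrow> ?thesis"
    by (intro Bochner_Integration.integrable_cong refl) (simp add: shape_count[OF _ assms] deviation_def)
  finally show ?thesis .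
qed

lemma tv_deviation_event:
  "{\<omega> \<in> space M. tv_dist (empirical_measure \<nu> (Z \<omega>) L) \<mu> > \<epsilon>} \<in> events"
proof -
  let ?B = "neighbourhood (sites L) :: (int ^ 'd) set"
  have "empirical_measure \<nu> (Z \<omega>) L = empirical_measure \<nu> (Z \<omega> \<inter> ?B) L" for \<omega>
    by (rule empirical_measure_local) auto
  then have "{\<omega> \<in> space M. tv_dist (empirical_measure \<nu> (Z \<omega>) L) \<mu> > \<epsilon>} =
    {\<omega> \<in> space M. Z \<omega> \<inter> ?B \<in> {G. G \<subseteq> ?B \<and> tv_dist (empirical_measure \<nu> G L) \<mu> > \<epsilon>}}"
    by auto
  also have "\<dots> \<in> events"
    by (rule local_event(1)) (auto intro: finite_neighbourhood)
  finally show ?thesis .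
qed

text \<open>
  Markov's inequality for the total deviation, followed by an interchange of expectation and sum over shapes.
\<close>

lemma tv_deviation_prob_le:
  assumes \<nu>: "prob_space \<nu>" "sets \<nu> = Pow homotopy_types" and "L > 0" "\<epsilon> > 0"
  defines "c \<equiv> \<epsilon> * (\<integral>F. shape_density F \<partial>count_space shapes) / 2"
  shows "prob {\<omega> \<in> space M. tv_dist (empirical_measure \<nu> (Z \<omega>) L) (type_law shape_density) > \<epsilon>}
    \<le> (\<integral>F. expectation (deviation L F) \<partial>count_space shapes) / c"
proof -
  let ?E = "{\<omega> \<in> space M. tv_dist (empirical_measure \<nu> (Z \<omega>) L) (type_law shape_density) > \<epsilon>}"
  let ?m = "\<integral>F. expectation (deviation L F) \<partial>count_space shapes"
  have c: "c > 0" using assms(4) total_density_pos by (simp add: c_def)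
  have dev_nonneg: "0 \<le> deviation L F \<omega>" for F \<omega> by (simp add: deviation_def)
  have ptw: "ennreal c * indicator ?E \<omega> \<le> (\<integral>\<^sup>+F. ennreal (deviation L F \<omega>) \<partial>count_space shapes)"
    if \<omega>: "\<omega> \<in> space M" for \<omega>
  proof (cases "\<omega> \<in> ?E")
    case True
    then have "\<epsilon> < 2 * (\<integral>F. deviation L F \<omega> \<partial>count_space shapes) / (\<integral>F. shape_density F \<partial>count_space shapes)"
      using tv_dist_le_total_deviation[OF \<nu> assms(3) \<omega>] by simp
    then have "c \<le> (\<integral>F. deviation L F \<omega> \<partial>count_space shapes)"
      using total_density_pos by (simp add: c_def field_simps)
    then have "ennreal c \<le> (\<integral>\<^sup>+F. ennreal (deviation L F \<omega>) \<partial>count_space shapes)"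
      using deviation_summable[OF \<omega>] dev_nonneg by (simp add: nn_integral_eq_integral ennreal_leI)
    then show ?thesis using True by simp
  qed auto
  have "ennreal c * emeasure M ?E = (\<integral>\<^sup>+\<omega>. ennreal c * indicator ?E \<omega> \<partial>M)"
    by (rule nn_integral_cmult_indicator[symmetric]) (rule tv_deviation_event)
  also have "\<dots> \<le> (\<integral>\<^sup>+\<omega>. \<integral>\<^sup>+F. ennreal (deviation L F \<omega>) \<partial>count_space shapes \<partial>M)"
    by (rule nn_integral_mono) (rule ptw)
  also have "\<dots> = (\<integral>\<^sup>+F. \<integral>\<^sup>+\<omega>. ennreal (deviation L F \<omega>) \<partial>M \<partial>count_space shapes)"
    using borel_measurable_integrable[OF deviation_integrable]
    by (intro nn_integral_count_space_nn_integral countable_shapes) simp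
  also have "\<dots> = (\<integral>\<^sup>+F. ennreal (expectation (deviation L F)) \<partial>count_space shapes)"
    by (intro nn_integral_cong nn_integral_eq_integral deviation_integrable) (auto simp: dev_nonneg)
  also have "\<dots> = ennreal ?m"
    by (intro nn_integral_eq_integral mean_deviation_integrable assms) (auto intro!: AE_I2 integral_nonneg_AE dev_nonneg)
  finally have "ennreal (c * prob ?E) \<le> ennreal ?m"
    using c by (simp add: emeasure_eq_measure ennreal_mult)
  moreover have "?m \<ge> 0" by (intro integral_nonneg_AE AE_I2 dev_nonneg)
  ultimately have "c * prob ?E \<le> ?m" by simp
  then show ?thesis using c by (simp add: field_simps)
qed

lemma empirical_measure_tendsto_type_law:
  assumes \<nu>: "prob_space \<nu>" "sets \<nu> = Pow homotopy_types"
  shows "tendsto_in_prob M (\<lambda>L \<omega>. empirical_measure \<nu> (Z \<omega>) L) (type_law shape_density)"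
  unfolding tendsto_in_prob_def
proof (intro allI impI conjI tv_deviation_event)
  fix \<epsilon> :: real assume "\<epsilon> > 0"
  define c where "c = \<epsilon> * (\<integral>F. shape_density F \<partial>count_space shapes) / 2"
  have lim: "(\<lambda>L. (\<integral>F. expectation (deviation L F) \<partial>count_space shapes) / c) \<longlonglongrightarrow> 0"
    using tendsto_divide_zero[OF mean_total_deviation_tendsto_0] .
  show "(\<lambda>L. prob {\<omega> \<in> space M. tv_dist (empirical_measure \<nu> (Z \<omega>) L) (type_law shape_density) > \<epsilon>}) \<longlonglongrightarrow> 0"
  proof (rule tendsto_sandwich[OF _ _ tendsto_const lim])
    show "\<forall>\<^sub>F L in sequentially. prob {\<omega> \<in> space M. tv_dist (empirical_measure \<nu> (Z \<omega>) L) (type_law shape_density) > \<epsilon>}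
      \<le> (\<integral>F. expectation (deviation L F) \<partial>count_space shapes) / c"
      using eventually_gt_at_top[of 0]
      by eventually_elim (unfold c_def, rule tv_deviation_prob_le[OF \<nu> _ \<open>\<epsilon> > 0\<close>])
  qed auto
qed

end

theorem theorem1p1:
  fixes M :: "'w measure"
    and Z :: "'w \<Rightarrow> (int ^ 'd::finite) set"
    and p :: real
    and \<nu> :: "(real ^ 'd) set set measure"
  assumes "CARD('d) \<ge> 2"
    and "0 < p" and "p < 1"
    and "prob_space M"
    and "random_coloring M Z p"
    and "prob_space \<nu>" and "sets \<nu> = Pow homotopy_types"
  shows "\<exists>\<mu> :: (real ^ 'd) set set measure.
           prob_space \<mu> \<and> sets \<mu> = Pow homotopy_types \<and>
           tendsto_in_prob M (\<lambda>L \<omega>. empirical_measure \<nu> (Z \<omega>) L) \<mu> \<and>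
           (\<forall>\<gamma>\<in>homotopy_types. measure \<mu> {\<gamma>} > 0)"
proof -
  interpret site_percolation M Z p
    using assms by (simp add: site_percolation_def site_percolation_axioms_def)
  note q = shape_density_integrable shape_density_nonneg total_density_pos
  show ?thesis
  proof (intro exI conjI ballI)
    show "prob_space (type_law shape_density)"
      by (rule prob_space_type_law[OF q])
    show "tendsto_in_prob M (\<lambda>L \<omega>. empirical_measure \<nu> (Z \<omega>) L) (type_law shape_density)"
      by (rule empirical_measure_tendsto_type_law[OF assms(6,7)])
    show "measure (type_law shape_density) {\<gamma>} > 0" if "\<gamma> \<in> homotopy_types" for \<gamma>
      by (rule type_law_pos[OF q(1) shape_density_pos q(3) that])
  qed simp
qed

end
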